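(* Let $\mathcal{P}:G\to\mathbb{Z}^d$ be a surjective group homomorphism with abelian kernel $N$, regarded as a module over $\Lambda_{\mathbb{Z}}=\mathbb{Z}[t_1^{\pm1},\ldots,t_d^{\pm1}]$ via conjugation. Let $\mathcal{Z}$ be a subgroup of $\mathbb{Z}^d$ isomorphic to $\mathbb{Z}^{d'}$ with $d'\leq d$, and let $H:=\mathcal{P}^{-1}(\mathcal{Z})$. Let $\{t'_1,\ldots,t'_{d'}\}\subset\Lambda_{\mathbb{Z}}$ be a $\mathbb{Z}$-basis of $\mathcal{Z}$ and let $x'_1,\ldots,x'_{d'}$ be elements of $\mathcal{P}^{-1}(t'_1),\ldots,\mathcal{P}^{-1}(t'_{d'})$ respectively. Let $I$ be the ideal of $\Lambda_{\mathbb{Z}}$ generated by $\{t'_1-1,\ldots,t'_{d'}-1\}$ and let $C$ be the $\Lambda_{\mathbb{Z}}$-submodule of $N$ generated by $\{[x'_i,x'_j]\mid1\leq i<j\leq d'\}$. Then there are two exact sequences of $\Lambda_{\mathbb{Z}}$-modules $$0\to N/(C+IN)\to H^{\mathrm{ab}}\to\mathbb{Z}^{d'}\to0,$$ $$0\to(C+IN)/IN\to N/IN\to N/(C+IN)\to0.$$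
   Context: $\{t_1,\ldots,t_d\}$ is a $\mathbb{Z}$-basis of $\mathbb{Z}^d$ (written multiplicatively, so $\mathbb{Z}^d\subset\Lambda_{\mathbb{Z}}^\times$), and $x_i\in\mathcal{P}^{-1}(t_i)$. The $\Lambda_{\mathbb{Z}}$-module structure on the abelian group $N$ is given by $t_iy=x_iyx_i^{-1}$ for $y\in N$, which is independent of the choice of $x_i$. $[x,y]=xyx^{-1}y^{-1}$, and $H^{\mathrm{ab}}$ is the abelianization of $H$, with $\Lambda_{\mathbb{Z}}$ acting through conjugation by $G$; $\mathbb{Z}^{d'}\cong\mathcal{Z}$ carries the trivial action of the $t_i$. *)

theory Defs
  imports "HOL-Algebra.Algebra"
begin

(* Z^d is free_Abelian_group {..<d}: finitely supported functions v with support in {..<d},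
   i.e. exponent vectors of the Laurent monomials t^v, with t_i = t^(frag_of i). *)
abbreviation Zpow :: "nat \<Rightarrow> (nat \<Rightarrow>\<^sub>0 int) monoid"
  where "Zpow d \<equiv> free_Abelian_group {..<d}"

definition Z_lincomb :: "nat \<Rightarrow> (nat \<Rightarrow> (nat \<Rightarrow>\<^sub>0 int)) \<Rightarrow> (nat \<Rightarrow>\<^sub>0 int) \<Rightarrow> (nat \<Rightarrow>\<^sub>0 int)"
  where "Z_lincomb n t c = (\<Sum>i<n. frag_cmul (Poly_Mapping.lookup c i) (t i))"

definition Z_basis :: "nat \<Rightarrow> (nat \<Rightarrow> (nat \<Rightarrow>\<^sub>0 int)) \<Rightarrow> (nat \<Rightarrow>\<^sub>0 int) set \<Rightarrow> bool"
  where "Z_basis n t S \<longleftrightarrow>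
    (\<forall>c \<in> carrier (Zpow n). Z_lincomb n t c = 0 \<longrightarrow> c = 0) \<and>
    Z_lincomb n t ` carrier (Zpow n) = S"

(* Laurent polynomials are the integral group ring of Z^d; multiplication of poly_mapping is
   convolution, so single v 1 is the monomial t^v. *)
definition laurent_ring :: "nat \<Rightarrow> ((nat \<Rightarrow>\<^sub>0 int) \<Rightarrow>\<^sub>0 int) ring"
  where "laurent_ring d =
    \<lparr>carrier = {p. Poly_Mapping.keys p \<subseteq> carrier (Zpow d)},
     monoid.mult = (*), monoid.one = 1, ring.zero = 0, ring.add = (+)\<rparr>"

abbreviation laurent_monom :: "(nat \<Rightarrow>\<^sub>0 int) \<Rightarrow> ((nat \<Rightarrow>\<^sub>0 int) \<Rightarrow>\<^sub>0 int)"
  where "laurent_monom v \<equiv> Poly_Mapping.single v 1"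

(* The (multiplicatively written) abelian group A, on which t^v acts by act v, made into a module
   by linear extension. The record fields mult and one play no role in a module. *)
definition laurent_module ::
  "('a, 'b) monoid_scheme \<Rightarrow> ((nat \<Rightarrow>\<^sub>0 int) \<Rightarrow> 'a \<Rightarrow> 'a) \<Rightarrow> ((nat \<Rightarrow>\<^sub>0 int) \<Rightarrow>\<^sub>0 int, 'a) module"
  where "laurent_module A act =
    \<lparr>carrier = carrier A, monoid.mult = undefined, monoid.one = undefined,
     ring.zero = \<one>\<^bsub>A\<^esub>, ring.add = monoid.mult A,
     smult = (\<lambda>p a. finprod A (\<lambda>v. act v a [^]\<^bsub>A\<^esub> Poly_Mapping.lookup p v) (Poly_Mapping.keys p))\<rparr>"

(* inv_into (carrier G) P v is some lift of v to G; the choice is immaterial,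
   see smult_kernel_module and smult_abelianization_module below. *)
definition kernel_module ::
  "('a, 'b) monoid_scheme \<Rightarrow> nat \<Rightarrow> ('a \<Rightarrow> (nat \<Rightarrow>\<^sub>0 int)) \<Rightarrow> ((nat \<Rightarrow>\<^sub>0 int) \<Rightarrow>\<^sub>0 int, 'a) module"
  where "kernel_module G d P =
    laurent_module (G\<lparr>carrier := kernel G (Zpow d) P\<rparr>)
      (\<lambda>v y. let x = inv_into (carrier G) P v in x \<otimes>\<^bsub>G\<^esub> y \<otimes>\<^bsub>G\<^esub> inv\<^bsub>G\<^esub> x)"

definition abelianization :: "('a, 'b) monoid_scheme \<Rightarrow> 'a set monoid"
  where "abelianization K = K Mod derived K (carrier K)"

definition abelianization_module ::
  "('a, 'b) monoid_scheme \<Rightarrow> ('a \<Rightarrow> (nat \<Rightarrow>\<^sub>0 int)) \<Rightarrow> 'a set \<Rightarrow> ((nat \<Rightarrow>\<^sub>0 int) \<Rightarrow>\<^sub>0 int, 'a set) module"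
  where "abelianization_module G P H =
    laurent_module (abelianization (G\<lparr>carrier := H\<rparr>))
      (\<lambda>v A. let x = inv_into (carrier G) P v in (\<lambda>h. x \<otimes>\<^bsub>G\<^esub> h \<otimes>\<^bsub>G\<^esub> inv\<^bsub>G\<^esub> x) ` A)"

definition trivial_module :: "nat \<Rightarrow> ((nat \<Rightarrow>\<^sub>0 int) \<Rightarrow>\<^sub>0 int, nat \<Rightarrow>\<^sub>0 int) module"
  where "trivial_module n = laurent_module (Zpow n) (\<lambda>v z. z)"

definition gen_submodule :: "('r, 'c) ring_scheme \<Rightarrow> ('r, 'm, 'd) module_scheme \<Rightarrow> 'm set \<Rightarrow> 'm set"
  where "gen_submodule R M S = \<Inter>{K. submodule K R M \<and> S \<subseteq> K}"

definition ideal_smult ::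
  "('r, 'c) ring_scheme \<Rightarrow> ('r, 'm, 'd) module_scheme \<Rightarrow> 'r set \<Rightarrow> 'm set"
  where "ideal_smult R M I = gen_submodule R M {a \<odot>\<^bsub>M\<^esub> y | a y. a \<in> I \<and> y \<in> carrier M}"

definition quot_module :: "('r, 'm, 'd) module_scheme \<Rightarrow> 'm set \<Rightarrow> ('r, 'm set) module"
  where "quot_module M K =
    \<lparr>carrier = a_rcosets\<^bsub>M\<^esub> K, monoid.mult = undefined, monoid.one = undefined,
     ring.zero = K, ring.add = set_add M,
     smult = (\<lambda>a A. \<Union>x\<in>A. K +>\<^bsub>M\<^esub> (a \<odot>\<^bsub>M\<^esub> x))\<rparr>"

definition module_hom ::
  "('r, 'c) ring_scheme \<Rightarrow> ('r, 'm, 'd) module_scheme \<Rightarrow> ('r, 'n, 'e) module_scheme \<Rightarrow> ('m \<Rightarrow> 'n) set"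
  where "module_hom R M M' =
    {f \<in> hom (add_monoid M) (add_monoid M').
       \<forall>a \<in> carrier R. \<forall>x \<in> carrier M. f (a \<odot>\<^bsub>M\<^esub> x) = a \<odot>\<^bsub>M'\<^esub> f x}"

definition short_exact_modules ::
  "('r, 'c) ring_scheme \<Rightarrow> ('r, 'm1, 'd1) module_scheme \<Rightarrow> ('m1 \<Rightarrow> 'm2) \<Rightarrow>
   ('r, 'm2, 'd2) module_scheme \<Rightarrow> ('m2 \<Rightarrow> 'm3) \<Rightarrow> ('r, 'm3, 'd3) module_scheme \<Rightarrow> bool"
  where "short_exact_modules R M1 f M2 g M3 \<longleftrightarrow>
    Module.module R M1 \<and> Module.module R M2 \<and> Module.module R M3 \<and>
    f \<in> module_hom R M1 M2 \<and> g \<in> module_hom R M2 M3 \<and>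
    inj_on f (carrier M1) \<and>
    f ` carrier M1 = a_kernel M2 M3 g \<and>
    g ` carrier M2 = carrier M3"

lemma smult_laurent_module_monom:
  assumes "comm_group A" "act v a \<in> carrier A"
  shows "laurent_monom v \<odot>\<^bsub>laurent_module A act\<^esub> a = act v a"
proof -
  interpret A: comm_group A by fact
  show ?thesis
    using assms(2) by (simp add: laurent_module_def A.int_pow_1)
qed

lemma conj_mult_kernel:
  assumes "group G" "group L" "P \<in> hom G L" "x \<in> carrier G" "x' \<in> carrier G" "P x = P x'"
  obtains n where "n \<in> kernel G L P" "x' = x \<otimes>\<^bsub>G\<^esub> n"
proof -
  interpret G: group G by fact
  interpret P: group_hom G L P by (simp add: assms group_hom_def group_hom_axioms_def)
  have "P (inv\<^bsub>G\<^esub> x \<otimes>\<^bsub>G\<^esub> x') = \<one>\<^bsub>L\<^esub>"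
    using assms by (metis G.inv_closed P.H.l_inv P.hom_closed P.hom_inv P.hom_mult)
  moreover have "x \<otimes>\<^bsub>G\<^esub> (inv\<^bsub>G\<^esub> x \<otimes>\<^bsub>G\<^esub> x') = x'"
    using assms by (simp flip: G.m_assoc)
  ultimately show ?thesis
    using assms by (intro that[of "inv\<^bsub>G\<^esub> x \<otimes>\<^bsub>G\<^esub> x'"]) (auto simp: kernel_def)
qed

lemma smult_kernel_module:
  assumes G: "group G" and P: "P \<in> hom G (Zpow d)"
    and ab: "comm_group (G\<lparr>carrier := kernel G (Zpow d) P\<rparr>)"
    and x: "x \<in> carrier G" "P x = v" and y: "y \<in> kernel G (Zpow d) P"
  shows "laurent_monom v \<odot>\<^bsub>kernel_module G d P\<^esub> y = x \<otimes>\<^bsub>G\<^esub> y \<otimes>\<^bsub>G\<^esub> inv\<^bsub>G\<^esub> x"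
proof -
  interpret G: group G by fact
  interpret P: group_hom G "Zpow d" P by (simp add: G P group_hom_def group_hom_axioms_def)
  define N where "N = kernel G (Zpow d) P"
  have nN: "N \<lhd> G" unfolding N_def by (rule P.normal_kernel)
  define s where "s = inv_into (carrier G) P v"
  have s: "s \<in> carrier G" "P s = v"
    unfolding s_def using x by (auto intro: inv_into_into f_inv_into_f)
  obtain n where n: "n \<in> N" "s = x \<otimes>\<^bsub>G\<^esub> n"
    using conj_mult_kernel[OF G _ P x(1) s(1)] x s unfolding N_def by auto
  have yN: "y \<in> N" and yc: "y \<in> carrier G" and nc: "n \<in> carrier G"
    using y n unfolding N_def kernel_def by auto
  have comm: "n \<otimes>\<^bsub>G\<^esub> y = y \<otimes>\<^bsub>G\<^esub> n"
    using comm_monoid.m_comm[of "G\<lparr>carrier := N\<rparr>" n y] ab yN n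
    by (simp add: comm_group_def N_def)
  have "s \<otimes>\<^bsub>G\<^esub> y \<otimes>\<^bsub>G\<^esub> inv\<^bsub>G\<^esub> s = x \<otimes>\<^bsub>G\<^esub> (n \<otimes>\<^bsub>G\<^esub> y) \<otimes>\<^bsub>G\<^esub> inv\<^bsub>G\<^esub> n \<otimes>\<^bsub>G\<^esub> inv\<^bsub>G\<^esub> x"
    using x yc nc by (simp add: n(2) G.inv_mult_group G.m_assoc)
  also have "\<dots> = x \<otimes>\<^bsub>G\<^esub> y \<otimes>\<^bsub>G\<^esub> inv\<^bsub>G\<^esub> x"
    using x yc nc by (simp add: comm G.m_assoc)
  finally have eq: "s \<otimes>\<^bsub>G\<^esub> y \<otimes>\<^bsub>G\<^esub> inv\<^bsub>G\<^esub> s = x \<otimes>\<^bsub>G\<^esub> y \<otimes>\<^bsub>G\<^esub> inv\<^bsub>G\<^esub> x" .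
  have "x \<otimes>\<^bsub>G\<^esub> y \<otimes>\<^bsub>G\<^esub> inv\<^bsub>G\<^esub> x \<in> N"
    using normal.inv_op_closed2[OF nN x(1) yN] .
  then show ?thesis
    unfolding kernel_module_def
    by (subst smult_laurent_module_monom) (use ab eq in \<open>auto simp: Let_def s_def N_def\<close>)
qed

lemma smult_abelianization_module:
  fixes G (structure)
  assumes G: "group G" and P: "P \<in> hom G (Zpow d)"
    and Z: "subgroup Z (Zpow d)" and H: "H = {x \<in> carrier G. P x \<in> Z}"
    and x: "x \<in> carrier G" "P x = v" and h: "h \<in> H"
  shows "laurent_monom v \<odot>\<^bsub>abelianization_module G P H\<^esub> (derived G H #> h)
         = derived G H #> (x \<otimes> h \<otimes> inv x)"
proof -
  interpret G: group G by fact
  interpret P: group_hom G "Zpow d" P by (simp add: G P group_hom_def group_hom_axioms_def)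
  have Pconj: "P (y \<otimes> k \<otimes> inv y) = P k" if "y \<in> carrier G" "k \<in> carrier G" for y k
  proof -
    have "P (y \<otimes> k \<otimes> inv y) = P (y \<otimes> k) \<otimes>\<^bsub>Zpow d\<^esub> P (inv y)"
      using that by (simp only: P.hom_mult G.m_closed G.inv_closed)
    also have "\<dots> = P (inv y) \<otimes>\<^bsub>Zpow d\<^esub> P (y \<otimes> k)"
      by (simp add: free_Abelian_group_def add.commute)
    also have "\<dots> = P (inv y \<otimes> (y \<otimes> k))"
      using that by (simp only: P.hom_mult G.m_closed G.inv_closed)
    also have "inv y \<otimes> (y \<otimes> k) = k"
      using that by (simp flip: G.m_assoc)
    finally show ?thesis .
  qed
  have one: "P \<one> \<in> Z" using subgroup.one_closed[OF Z] P.hom_one by simp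
  have add: "u + w \<in> Z" if "u \<in> Z" "w \<in> Z" for u w
    using subgroup.m_closed[OF Z that] by (simp add: free_Abelian_group_def)
  have subH: "subgroup H G"
    unfolding H
  proof (rule G.subgroupI)
    show "{x \<in> carrier G. P x \<in> Z} \<noteq> {}" using one by blast
  qed (use Z in \<open>auto simp: add P.hom_inv subgroup.m_inv_closed simp del: inv_free_Abelian_group\<close>)
  have conjH: "y \<otimes> k \<otimes> inv y \<in> H" if "y \<in> carrier G" "k \<in> H" for y k
  proof -
    have "k \<in> carrier G" "P k \<in> Z" using that by (auto simp: H)
    then show ?thesis
      unfolding H using that(1) Pconj[of y k] by (intro CollectI conjI) (simp_all only: G.m_closed G.inv_closed)
  qed
  have nH: "H \<lhd> G"
    unfolding G.normal_inv_iff using subH conjH by blast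
  define D where "D = derived G H"
  have nD: "D \<lhd> G" unfolding D_def by (rule G.derived_is_normal[OF nH])
  interpret D: normal D G by (fact nD)
  have Hc: "H \<subseteq> carrier G" by (auto simp: H)
  have comm: "a \<otimes> b \<otimes> inv a \<otimes> inv b \<in> D" if "a \<in> H" "b \<in> H" for a b
    unfolding D_def derived_def using that by (intro generate.incl) auto
  define s where "s = inv_into (carrier G) P v"
  have s: "s \<in> carrier G" "P s = v"
    unfolding s_def using x by (auto intro: inv_into_into f_inv_into_f)
  obtain n where n: "n \<in> kernel G (Zpow d) P" "s = x \<otimes> n"
    using conj_mult_kernel[OF G _ P x(1) s(1)] x s by auto
  have nH: "n \<in> H" using n one by (auto simp: H kernel_def)
  have nc: "n \<in> carrier G" and hc: "h \<in> carrier G" using nH h Hc by auto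
  let ?c = "n \<otimes> h \<otimes> inv n \<otimes> inv h"
  have "s \<otimes> h \<otimes> inv s = (x \<otimes> ?c \<otimes> inv x) \<otimes> (x \<otimes> h \<otimes> inv x)"
  proof -
    have "s \<otimes> h \<otimes> inv s = x \<otimes> (n \<otimes> (h \<otimes> (inv n \<otimes> inv x)))"
      using x nc hc by (simp add: n(2) G.inv_mult_group G.m_assoc)
    also have "\<dots> = (x \<otimes> ?c \<otimes> inv x) \<otimes> (x \<otimes> h \<otimes> inv x)"
      using x nc hc by (simp add: G.m_assoc G.inv_solve_left)
        (simp add: G.m_assoc[symmetric])
    finally show ?thesis .
  qed
  moreover have "x \<otimes> ?c \<otimes> inv x \<in> D"
    using normal.inv_op_closed2[OF nD x(1) comm[OF nH h]] .
  ultimately have same: "D #> (s \<otimes> h \<otimes> inv s) = D #> (x \<otimes> h \<otimes> inv x)"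
    using G.coset_mult_assoc[OF D.subset, of "x \<otimes> ?c \<otimes> inv x" "x \<otimes> h \<otimes> inv x"]
      G.coset_join2[OF _ D.subgroup_axioms, of "x \<otimes> ?c \<otimes> inv x"] x hc nc
    by (simp only: G.m_closed G.inv_closed)
  have img: "(\<lambda>h. s \<otimes> h \<otimes> inv s) ` (D #> h) = D #> (s \<otimes> h \<otimes> inv s)"
  proof (intro equalityI subsetI)
    fix z assume "z \<in> (\<lambda>h. s \<otimes> h \<otimes> inv s) ` (D #> h)"
    then obtain e where e: "e \<in> D" "z = s \<otimes> (e \<otimes> h) \<otimes> inv s" by (auto simp: r_coset_def)
    have "z = (s \<otimes> e \<otimes> inv s) \<otimes> (s \<otimes> h \<otimes> inv s)"
      using e s hc D.mem_carrier by (simp add: G.m_assoc) (simp flip: G.m_assoc)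
    then show "z \<in> D #> (s \<otimes> h \<otimes> inv s)"
      using D.inv_op_closed2[OF s(1) e(1)] by (auto simp: r_coset_def)
  next
    fix z assume "z \<in> D #> (s \<otimes> h \<otimes> inv s)"
    then obtain e where e: "e \<in> D" "z = e \<otimes> (s \<otimes> h \<otimes> inv s)" by (auto simp: r_coset_def)
    have "z = s \<otimes> ((inv s \<otimes> e \<otimes> s) \<otimes> h) \<otimes> inv s"
      using e s hc D.mem_carrier by (simp add: G.m_assoc) (simp flip: G.m_assoc)
    then show "z \<in> (\<lambda>h. s \<otimes> h \<otimes> inv s) ` (D #> h)"
      using D.inv_op_closed1[OF s(1) e(1)] by (auto simp: r_coset_def)
  qed
  define K where "K = G\<lparr>carrier := H\<rparr>"
  have K: "group K" unfolding K_def using subH by (rule subgroup.subgroup_is_group) fact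
  have DK: "derived K (carrier K) = D"
    unfolding K_def D_def using G.derived_consistent[OF _ subH] by simp
  have "comm_group (abelianization K)"
    unfolding abelianization_def using group.derived_quot_is_comm_group[OF K] .
  moreover have "D #> (x \<otimes> h \<otimes> inv x) \<in> carrier (abelianization K)"
  proof -
    have "x \<otimes> h \<otimes> inv x \<in> H" using x h by (intro conjH)
    then show ?thesis
      unfolding abelianization_def DK by (auto simp: FactGroup_def RCOSETS_def r_coset_def K_def)
  qed
  ultimately show ?thesis
    unfolding abelianization_module_def K_def[symmetric] D_def[symmetric]
    by (subst smult_laurent_module_monom) (simp_all add: Let_def img same flip: s_def)
qed

end

theory Submission
  imports Defs
begin

text \<open>
  Write \<open>\<Lambda>\<close> for the Laurent polynomial ring and \<open>N\<close> for the kernel of \<open>P\<close>. Everything rests on the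
  equality \<open>[H, H] = C + IN\<close> (\<open>derived_preimage\<close>), in which both sides are normal subgroups of \<open>G\<close>
  contained in \<open>N\<close>; such subgroups are the same thing as \<open>\<Lambda>\<close>-submodules of \<open>N\<close>
  (\<open>submodule_kernel_module_iff\<close>), since a subgroup of \<open>N\<close> is stable under \<open>\<Lambda>\<close> once it
  is stable under the monomials, and these act by conjugation.

  The inclusion from right to left holds because the generators of \<open>C\<close> are commutators of elements of
  \<open>H\<close>, and because \<open>(t\<^sub>i - 1) y = [x\<^sub>i, y]\<close> for \<open>y\<close> in \<open>N\<close>. As the elements of \<open>\<Lambda>\<close> that carry \<open>N\<close> into
  a given submodule form an ideal, the second fact handles all of \<open>IN\<close>. For the other inclusion, \<open>H\<close> is
  generated by \<open>N\<close> and the \<open>x\<^sub>i\<close> (\<open>H_generate\<close>), and these generators commute with each other modulo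
  \<open>C + IN\<close>: two elements of \<open>N\<close> because \<open>N\<close> is abelian, \<open>x\<^sub>i\<close> and \<open>y\<close> by the formula for \<open>(t\<^sub>i - 1) y\<close>,
  and \<open>x\<^sub>i\<close> and \<open>x\<^sub>j\<close> by the choice of \<open>C\<close>. A group whose generators commute is abelian, so \<open>[H, H]\<close>
  lies in \<open>C + IN\<close> (\<open>derived_generate_subset_normal\<close>).

  Given this, \<open>N/(C + IN) = N/[H, H]\<close> is literally a set of cosets contained in \<open>H/[H, H]\<close>, so the
  first map of the first sequence is an inclusion. The second one is induced by \<open>P\<close>, followed by taking
  coordinates in the basis of the subgroup of \<open>\<int>\<^sup>d\<close>; its kernel consists of the cosets of elements of
  \<open>N\<close>. The second sequence is the general one \<open>0 \<rightarrow> L/K \<rightarrow> M/K \<rightarrow> M/L \<rightarrow> 0\<close> for submodules \<open>K \<subseteq> L\<close> of a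
  module \<open>M\<close> (\<open>short_exact_submodule_quotients\<close>).
\<close>

section \<open>Modules over the Laurent polynomial ring\<close>

text \<open>
  Since the Laurent polynomials are the free abelian group on the monomials, an identity that is additive
  in \<open>p\<close> needs checking only for monomials. Stepping by differences rather than sums makes a separate
  case for negatives superfluous.
\<close>

lemma laurent_induct [consumes 1, case_names zero monom diff]:
  assumes "p \<in> carrier (laurent_ring d)"
    and "Q 0"
    and "\<And>v. v \<in> carrier (Zpow d) \<Longrightarrow> Q (laurent_monom v)"
    and "\<And>p q. \<lbrakk>p \<in> carrier (laurent_ring d); q \<in> carrier (laurent_ring d); Q p; Q q\<rbrakk> \<Longrightarrow> Q (p - q)"
  shows "Q p"
proof -
  have "Poly_Mapping.keys p \<subseteq> carrier (Zpow d)"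
    using assms(1) by (simp add: laurent_ring_def)
  then have "p \<in> carrier (laurent_ring d) \<and> Q p"
  proof (induction p rule: frag_induction)
    case zero
    show ?case using assms(2) by (simp add: laurent_ring_def)
  next
    case (one v)
    then show ?case using assms(3)[of v] by (simp add: laurent_ring_def)
  next
    case (diff a b)
    then show ?case
      using assms(4)[of a b] keys_diff[of a b] unfolding laurent_ring_def by auto
  qed
  then show ?thesis by simp
qed

lemma laurent_monom_in_carrier: "v \<in> carrier (Zpow d) \<Longrightarrow> laurent_monom v \<in> carrier (laurent_ring d)"
  by (simp add: laurent_ring_def)

lemma diff_in_laurent_ring:
  assumes "p \<in> carrier (laurent_ring d)" "q \<in> carrier (laurent_ring d)"
  shows "p - q \<in> carrier (laurent_ring d)"
  using assms keys_diff[of p q] by (auto simp: laurent_ring_def simp del: carrier_free_Abelian_group_iff)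

lemma add_closed_Zpow: "u \<in> carrier (Zpow d) \<Longrightarrow> v \<in> carrier (Zpow d) \<Longrightarrow> u + v \<in> carrier (Zpow d)"
  using keys_add[of u v] by auto

lemma cring_laurent_ring: "cring (laurent_ring d)"
proof (rule cringI)
  show "abelian_group (laurent_ring d)"
  proof (rule abelian_groupI)
    fix p assume p: "p \<in> carrier (laurent_ring d)"
    then show "\<exists>q\<in>carrier (laurent_ring d). q \<oplus>\<^bsub>laurent_ring d\<^esub> p = \<zero>\<^bsub>laurent_ring d\<^esub>"
      by (intro bexI[of _ "- p"]) (simp_all add: laurent_ring_def)
  next
    fix p q assume "p \<in> carrier (laurent_ring d)" "q \<in> carrier (laurent_ring d)"
    then show "p \<oplus>\<^bsub>laurent_ring d\<^esub> q \<in> carrier (laurent_ring d)"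
      using keys_add[of p q] by (auto simp: laurent_ring_def simp del: carrier_free_Abelian_group_iff)
  qed (simp_all add: laurent_ring_def algebra_simps)
  show "Group.comm_monoid (laurent_ring d)"
  proof (rule comm_monoidI)
    fix p q assume "p \<in> carrier (laurent_ring d)" "q \<in> carrier (laurent_ring d)"
    then show "p \<otimes>\<^bsub>laurent_ring d\<^esub> q \<in> carrier (laurent_ring d)"
      using keys_mult[of p q] add_closed_Zpow[of _ d]
      by (simp add: laurent_ring_def del: carrier_free_Abelian_group_iff) blast
  qed (simp_all add: laurent_ring_def algebra_simps)
qed (simp_all add: laurent_ring_def algebra_simps)

text \<open>
  An action of the group \<open>\<int>\<^sup>d\<close> on an abelian group by automorphisms: exactly the data that extend
  linearly to a module over the group ring.
\<close>

locale laurent_action = comm_group A for A (structure) +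
  fixes d :: nat and act :: "(nat \<Rightarrow>\<^sub>0 int) \<Rightarrow> 'a \<Rightarrow> 'a"
  assumes act_hom: "v \<in> carrier (Zpow d) \<Longrightarrow> act v \<in> hom A A"
    and act_zero: "a \<in> carrier A \<Longrightarrow> act 0 a = a"
    and act_add: "\<lbrakk>u \<in> carrier (Zpow d); v \<in> carrier (Zpow d); a \<in> carrier A\<rbrakk>
                   \<Longrightarrow> act (u + v) a = act u (act v a)"
begin

abbreviation "M \<equiv> laurent_module A act"

lemma act_closed: "\<lbrakk>v \<in> carrier (Zpow d); a \<in> carrier A\<rbrakk> \<Longrightarrow> act v a \<in> carrier A"
  using act_hom by (auto simp: hom_def)

text \<open>
  Enlarging the index set beyond the support of \<open>p\<close> makes it possible to add the products that
  define \<open>p \<odot> a\<close> and \<open>q \<odot> a\<close> over a common index set.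
\<close>

lemma smult_superset:
  assumes "finite S" "Poly_Mapping.keys p \<subseteq> S" "S \<subseteq> carrier (Zpow d)" "a \<in> carrier A"
  shows "p \<odot>\<^bsub>M\<^esub> a = (\<Otimes>v\<in>S. act v a [^] Poly_Mapping.lookup p v)"
proof -
  have "(\<Otimes>v\<in>Poly_Mapping.keys p. act v a [^] Poly_Mapping.lookup p v)
      = (\<Otimes>v\<in>S. act v a [^] Poly_Mapping.lookup p v)"
    using assms act_closed
    by (intro finprod_mono_neutral_cong_left) (auto simp: in_keys_iff simp del: carrier_free_Abelian_group_iff)
  then show ?thesis by (simp add: laurent_module_def)
qed

lemma smult_in_carrier:
  assumes "p \<in> carrier (laurent_ring d)" "a \<in> carrier A"
  shows "p \<odot>\<^bsub>M\<^esub> a \<in> carrier A"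
  using assms act_closed
  by (auto simp: laurent_module_def laurent_ring_def subset_iff simp del: carrier_free_Abelian_group_iff intro!: finprod_closed)

lemma smult_add:
  assumes "p \<in> carrier (laurent_ring d)" "q \<in> carrier (laurent_ring d)" "a \<in> carrier A"
  shows "(p + q) \<odot>\<^bsub>M\<^esub> a = (p \<odot>\<^bsub>M\<^esub> a) \<otimes> (q \<odot>\<^bsub>M\<^esub> a)"
proof -
  let ?S = "Poly_Mapping.keys p \<union> Poly_Mapping.keys q"
  have S: "finite ?S" "?S \<subseteq> carrier (Zpow d)" "Poly_Mapping.keys (p + q) \<subseteq> ?S"
    using assms keys_add[of p q] by (auto simp: laurent_ring_def simp del: carrier_free_Abelian_group_iff)
  have cl: "act v a \<in> carrier A" if "v \<in> ?S" for v using S that act_closed assms by blast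
  have "(p + q) \<odot>\<^bsub>M\<^esub> a = (\<Otimes>v\<in>?S. act v a [^] Poly_Mapping.lookup (p + q) v)"
    using S assms(3) by (intro smult_superset)
  also have "\<dots> = (\<Otimes>v\<in>?S. act v a [^] Poly_Mapping.lookup p v \<otimes> act v a [^] Poly_Mapping.lookup q v)"
    using cl by (intro finprod_cong') (auto simp: lookup_add int_pow_mult)
  also have "\<dots> = (\<Otimes>v\<in>?S. act v a [^] Poly_Mapping.lookup p v) \<otimes> (\<Otimes>v\<in>?S. act v a [^] Poly_Mapping.lookup q v)"
    using cl by (intro finprod_multf) auto
  also have "\<dots> = (p \<odot>\<^bsub>M\<^esub> a) \<otimes> (q \<odot>\<^bsub>M\<^esub> a)"
    using S assms(3) smult_superset[of ?S p a] smult_superset[of ?S q a] by simp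
  finally show ?thesis .
qed

lemma smult_diff:
  assumes "p \<in> carrier (laurent_ring d)" "q \<in> carrier (laurent_ring d)" "a \<in> carrier A"
  shows "(p - q) \<odot>\<^bsub>M\<^esub> a = (p \<odot>\<^bsub>M\<^esub> a) \<otimes> inv (q \<odot>\<^bsub>M\<^esub> a)"
  using smult_add[of "p - q" q a] assms diff_in_laurent_ring[of p d q]
  by (simp add: inv_solve_right smult_in_carrier)

lemma smult_zero: "0 \<odot>\<^bsub>M\<^esub> a = \<one>"
  by (simp add: laurent_module_def)

lemma smult_monom: "\<lbrakk>v \<in> carrier (Zpow d); a \<in> carrier A\<rbrakk> \<Longrightarrow> laurent_monom v \<odot>\<^bsub>M\<^esub> a = act v a"
  by (intro smult_laurent_module_monom comm_group_axioms act_closed)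

lemma smult_mult_distrib:
  assumes "p \<in> carrier (laurent_ring d)" "a \<in> carrier A" "b \<in> carrier A"
  shows "p \<odot>\<^bsub>M\<^esub> (a \<otimes> b) = (p \<odot>\<^bsub>M\<^esub> a) \<otimes> (p \<odot>\<^bsub>M\<^esub> b)"
  using assms(1)
proof (induction p rule: laurent_induct)
  case zero
  show ?case by (simp add: smult_zero)
next
  case (monom v)
  show ?case
    using monom assms hom_mult[OF act_hom] by (simp only: smult_monom m_closed)
next
  case (diff p q)
  then show ?case
    using assms by (simp add: smult_diff smult_in_carrier inv_mult_group m_ac)
qed

lemma abelian_group_laurent_module: "abelian_group M"
proof (intro comm_group_abelian_groupI comm_groupI)
  fix a assume "a \<in> carrier (add_monoid M)"
  then show "\<exists>b\<in>carrier (add_monoid M). b \<otimes>\<^bsub>add_monoid M\<^esub> a = \<one>\<^bsub>add_monoid M\<^esub>"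
    by (intro bexI[of _ "inv a"]) (simp_all add: laurent_module_def)
qed (simp_all add: laurent_module_def m_ac)

text \<open>
  Both sides are additive in \<open>p\<close> and in \<open>q\<close>, and for two monomials the claim is the compatibility of the
  action with addition of exponents.
\<close>

lemma smult_times:
  assumes "p \<in> carrier (laurent_ring d)" "q \<in> carrier (laurent_ring d)" "a \<in> carrier A"
  shows "(p * q) \<odot>\<^bsub>M\<^esub> a = p \<odot>\<^bsub>M\<^esub> (q \<odot>\<^bsub>M\<^esub> a)"
proof -
  interpret L: cring "laurent_ring d" by (rule cring_laurent_ring)
  have times_closed: "p * q \<in> carrier (laurent_ring d)"
    if "p \<in> carrier (laurent_ring d)" "q \<in> carrier (laurent_ring d)" for p q
    using L.m_closed[OF that] by (simp add: laurent_ring_def)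
  show ?thesis
    using assms(1)
  proof (induction p rule: laurent_induct)
    case zero
    show ?case by (simp add: smult_zero)
  next
    case (monom u)
    show ?case
      using assms(2)
    proof (induction q rule: laurent_induct)
      case zero
      show ?case using monom assms(3) hom_one[OF act_hom is_group is_group] by (simp add: smult_zero smult_monom del: carrier_free_Abelian_group_iff)
    next
      case (monom v)
      show ?case
        using monom \<open>u \<in> _\<close> assms(3) 
        by (simp add: mult_single smult_monom act_add act_closed add_closed_Zpow del: carrier_free_Abelian_group_iff)
    next
      case (diff q r)
      note u = monom laurent_monom_in_carrier[OF monom]
      interpret h: group_hom A A "act u"
        by unfold_locales (rule act_hom[OF monom])
      show ?case
        using diff u assms(3)
        by (simp add: right_diff_distrib smult_diff times_closed smult_in_carrier smult_monom
              del: carrier_free_Abelian_group_iff)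
    qed
  next
    case (diff p r)
    then show ?case
      using assms by (simp add: left_diff_distrib smult_diff times_closed smult_in_carrier)
  qed
qed

lemma module_laurent_module: "Module.module (laurent_ring d) M"
proof -
  have [simp]: "carrier M = carrier A" "add M = monoid.mult A"
    by (simp_all add: laurent_module_def)
  have [simp]: "add (laurent_ring d) = (+)" "monoid.mult (laurent_ring d) = (*)"
    "monoid.one (laurent_ring d) = laurent_monom 0"
    by (simp_all add: laurent_ring_def)
  have "laurent_monom 0 \<odot>\<^bsub>M\<^esub> a = a" if "a \<in> carrier A" for a
    using that smult_monom[of 0 a] by (simp add: act_zero)
  then show ?thesis
    by (intro moduleI) (simp_all add: cring_laurent_ring abelian_group_laurent_module smult_in_carrier
      smult_add smult_mult_distrib smult_times)
qed

end

text \<open>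
  Monomials span \<open>\<Lambda>\<close> over \<open>\<int>\<close>, and a group homomorphism respects integer multiples. This criterion gives the
  linearity of \<open>N \<rightarrow> H/[H, H]\<close> and of the map that \<open>P\<close> induces on \<open>H/[H, H]\<close>.
\<close>

lemma module_hom_laurentI:
  assumes A: "laurent_action A d act" and B: "laurent_action B d act'"
    and f: "f \<in> hom A B"
    and equivariant: "\<And>v a. \<lbrakk>v \<in> carrier (Zpow d); a \<in> carrier A\<rbrakk> \<Longrightarrow> f (act v a) = act' v (f a)"
  shows "f \<in> module_hom (laurent_ring d) (laurent_module A act) (laurent_module B act')"
proof -
  interpret A: laurent_action A d act by (rule A)
  interpret B: laurent_action B d act' by (rule B)
  interpret f: group_hom A B f by unfold_locales (rule f)
  have "f (p \<odot>\<^bsub>A.M\<^esub> a) = p \<odot>\<^bsub>B.M\<^esub> f a" if "p \<in> carrier (laurent_ring d)" "a \<in> carrier A" for p a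
    using that(1)
  proof (induction p rule: laurent_induct)
    case zero
    show ?case by (simp add: A.smult_zero B.smult_zero)
  next
    case (monom v)
    then show ?case
      using that by (simp add: A.smult_monom B.smult_monom equivariant del: carrier_free_Abelian_group_iff)
  next
    case (diff p q)
    then show ?case
      using that by (simp add: A.smult_diff B.smult_diff A.smult_in_carrier)
  qed
  then show ?thesis
    using f by (simp add: module_hom_def laurent_module_def hom_def)
qed

lemma (in laurent_action) submodule_laurentI:
  assumes K: "subgroup K A"
    and stable: "\<And>v a. \<lbrakk>v \<in> carrier (Zpow d); a \<in> K\<rbrakk> \<Longrightarrow> act v a \<in> K"
  shows "submodule K (laurent_ring d) M"
proof -
  interpret K: subgroup K A by (rule K)
  have "subgroup K (add_monoid M)"
    using K.one_closed K.m_closed K.m_inv_closed K.subset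
    by (intro subgroup.intro) (auto simp: laurent_module_def m_inv_def)
  moreover have "p \<odot>\<^bsub>M\<^esub> a \<in> K" if "p \<in> carrier (laurent_ring d)" "a \<in> K" for p a
    using that(1)
  proof (induction p rule: laurent_induct)
    case zero
    show ?case by (simp add: smult_zero)
  next
    case (monom v)
    then show ?case
      using that stable by (simp add: smult_monom del: carrier_free_Abelian_group_iff)
  next
    case (diff p q)
    then show ?case
      using that by (simp add: smult_diff)
  qed
  ultimately show ?thesis by (simp add: submodule_def submodule_axioms_def)
qed

lemma (in laurent_action) submodule_laurentD:
  assumes "submodule K (laurent_ring d) M"
  shows "subgroup K A" and "\<lbrakk>v \<in> carrier (Zpow d); a \<in> K\<rbrakk> \<Longrightarrow> act v a \<in> K"
proof -
  interpret K: submodule K "laurent_ring d" M by (rule assms)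
  have inv: "inv\<^bsub>add_monoid M\<^esub> a = inv a" for a
    by (simp add: m_inv_def laurent_module_def)
  show "subgroup K A"
  proof (rule subgroup.intro)
    show "K \<subseteq> carrier A" using K.subset by (simp add: laurent_module_def)
    show "\<one> \<in> K" using K.one_closed by (simp add: laurent_module_def)
    show "a \<otimes> b \<in> K" if "a \<in> K" "b \<in> K" for a b
      using K.m_closed[OF that] by (simp add: laurent_module_def)
    show "inv a \<in> K" if "a \<in> K" for a
      using K.m_inv_closed[OF that] by (simp only: inv)
  qed
  show "act v a \<in> K" if "v \<in> carrier (Zpow d)" "a \<in> K"
  proof -
    have "a \<in> carrier A" using K.subset that(2) by (auto simp: laurent_module_def)
    then show ?thesis
      using K.smult_closed[OF laurent_monom_in_carrier[OF that(1)] that(2)]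
      by (simp only: smult_monom[OF that(1)])
  qed
qed

section \<open>Submodules and quotient modules\<close>

context module
begin

lemma submodule_gen_submodule:
  assumes "S \<subseteq> carrier M"
  shows "submodule (gen_submodule R M S) R M"
proof (rule submoduleI)
  let ?F = "{K. submodule K R M \<and> S \<subseteq> K}"
  have "carrier M \<in> ?F" using assms carrier_is_submodule by simp
  then show "gen_submodule R M S \<subseteq> carrier M" unfolding gen_submodule_def by blast
qed (auto simp: gen_submodule_def dest: submoduleE submodule.axioms(1)[THEN subgroup.one_closed])

lemma gen_submodule_minimal: "\<lbrakk>submodule K R M; S \<subseteq> K\<rbrakk> \<Longrightarrow> gen_submodule R M S \<subseteq> K"
  by (auto simp: gen_submodule_def)

lemma gen_submodule_incl: "S \<subseteq> gen_submodule R M S"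
  by (auto simp: gen_submodule_def)

lemma submodule_set_add:
  assumes "submodule K R M" "submodule L R M"
  shows "submodule (K <+>\<^bsub>M\<^esub> L) R M"
proof -
  note K = submoduleE[OF assms(1)] and L = submoduleE[OF assms(2)]
  have mem: "x \<in> K <+>\<^bsub>M\<^esub> L \<longleftrightarrow> (\<exists>k\<in>K. \<exists>l\<in>L. x = k \<oplus>\<^bsub>M\<^esub> l)" for x
    by (auto simp: set_add_def')
  show ?thesis
  proof (rule submoduleI)
    show "K <+>\<^bsub>M\<^esub> L \<subseteq> carrier M"
      using K(1) L(1) by (auto simp: mem subsetD)
    show "\<zero>\<^bsub>M\<^esub> \<in> K <+>\<^bsub>M\<^esub> L"
      using subgroup.one_closed[OF submodule.axioms(1)] assms unfolding mem by force
  next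
    fix x assume "x \<in> K <+>\<^bsub>M\<^esub> L"
    then obtain k l where kl: "k \<in> K" "l \<in> L" "x = k \<oplus>\<^bsub>M\<^esub> l" by (auto simp: mem)
    then have "\<ominus>\<^bsub>M\<^esub> x = \<ominus>\<^bsub>M\<^esub> k \<oplus>\<^bsub>M\<^esub> \<ominus>\<^bsub>M\<^esub> l"
      using K(1) L(1) by (simp add: M.minus_add subsetD)
    then show "\<ominus>\<^bsub>M\<^esub> x \<in> K <+>\<^bsub>M\<^esub> L"
      using kl K(3) L(3) by (auto simp: mem)
    fix a assume "a \<in> carrier R"
    then show "a \<odot>\<^bsub>M\<^esub> x \<in> K <+>\<^bsub>M\<^esub> L"
      using kl K(1) L(1) K(4)[of a k] L(4)[of a l] smult_r_distr[of a k l] unfolding mem by (metis subsetD)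
  next
    fix x y assume "x \<in> K <+>\<^bsub>M\<^esub> L" "y \<in> K <+>\<^bsub>M\<^esub> L"
    then obtain k l k' l' where kl: "k \<in> K" "l \<in> L" "x = k \<oplus>\<^bsub>M\<^esub> l" "k' \<in> K" "l' \<in> L" "y = k' \<oplus>\<^bsub>M\<^esub> l'"
      by (auto simp: mem)
    moreover from kl have "k \<in> carrier M" "l \<in> carrier M" "k' \<in> carrier M" "l' \<in> carrier M"
      using K(1) L(1) by auto
    ultimately have "x \<oplus>\<^bsub>M\<^esub> y = (k \<oplus>\<^bsub>M\<^esub> k') \<oplus>\<^bsub>M\<^esub> (l \<oplus>\<^bsub>M\<^esub> l')"
      by (simp add: M.a_ac)
    then show "x \<oplus>\<^bsub>M\<^esub> y \<in> K <+>\<^bsub>M\<^esub> L"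
      using kl K(5)[of k k'] L(5)[of l l'] unfolding mem by blast
  qed
qed

lemma subset_set_add:
  assumes "submodule K R M" "submodule L R M"
  shows "K \<subseteq> K <+>\<^bsub>M\<^esub> L" and "L \<subseteq> K <+>\<^bsub>M\<^esub> L"
proof -
  have z: "\<zero>\<^bsub>M\<^esub> \<in> K" "\<zero>\<^bsub>M\<^esub> \<in> L"
    using subgroup.one_closed[OF submodule.axioms(1)] assms by force+
  have c: "K \<subseteq> carrier M" "L \<subseteq> carrier M"
    using submoduleE(1) assms by auto
  show "K \<subseteq> K <+>\<^bsub>M\<^esub> L"
  proof
    fix x assume "x \<in> K"
    with z c show "x \<in> K <+>\<^bsub>M\<^esub> L"
      unfolding set_add_def' by (intro UN_I[of x] UN_I[of "\<zero>\<^bsub>M\<^esub>"]) auto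
  qed
  show "L \<subseteq> K <+>\<^bsub>M\<^esub> L"
  proof
    fix x assume "x \<in> L"
    with z c show "x \<in> K <+>\<^bsub>M\<^esub> L"
      unfolding set_add_def' by (intro UN_I[of x] UN_I[of "\<zero>\<^bsub>M\<^esub>"]) auto
  qed
qed

lemma set_add_subset:
  assumes "submodule D R M" "K \<subseteq> D" "L \<subseteq> D"
  shows "K <+>\<^bsub>M\<^esub> L \<subseteq> D"
  using assms submoduleE(5)[OF assms(1)] by (auto simp: set_add_def')

lemma submodule_ideal_smult:
  assumes "I \<subseteq> carrier R"
  shows "submodule (ideal_smult R M I) R M"
  unfolding ideal_smult_def using assms by (intro submodule_gen_submodule) auto

lemma ideal_smult_incl: "\<lbrakk>a \<in> I; y \<in> carrier M\<rbrakk> \<Longrightarrow> a \<odot>\<^bsub>M\<^esub> y \<in> ideal_smult R M I"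
  unfolding ideal_smult_def by (rule subsetD[OF gen_submodule_incl]) auto

text \<open>
  The ring elements that map \<open>M\<close> into \<open>D\<close> form an ideal, so it suffices to test the generators of
  the ideal.
\<close>

lemma ideal_smult_genideal_subset:
  assumes D: "submodule D R M" and S: "S \<subseteq> carrier R"
    and gen: "\<And>s y. \<lbrakk>s \<in> S; y \<in> carrier M\<rbrakk> \<Longrightarrow> s \<odot>\<^bsub>M\<^esub> y \<in> D"
  shows "ideal_smult R M (Idl\<^bsub>R\<^esub> S) \<subseteq> D"
proof -
  note DE = submoduleE[OF D]
  let ?J = "{a \<in> carrier R. \<forall>y\<in>carrier M. a \<odot>\<^bsub>M\<^esub> y \<in> D}"
  have zero: "\<zero>\<^bsub>M\<^esub> \<in> D" using subgroup.one_closed[OF submodule.axioms(1)[OF D]] by simp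
  have "ideal ?J R"
  proof (rule idealI)
    show "subgroup ?J (add_monoid R)"
    proof (rule subgroup.intro)
      show "\<one>\<^bsub>add_monoid R\<^esub> \<in> ?J" using zero by simp
      show "a \<otimes>\<^bsub>add_monoid R\<^esub> b \<in> ?J" if "a \<in> ?J" "b \<in> ?J" for a b
        using that DE(5) by (simp add: smult_l_distr)
      show "inv\<^bsub>add_monoid R\<^esub> a \<in> ?J" if "a \<in> ?J" for a
        using that DE(3) by (simp add: smult_l_minus flip: a_inv_def)
    qed auto
  next
    fix a b assume a: "a \<in> ?J" and b: "b \<in> carrier R"
    show "b \<otimes>\<^bsub>R\<^esub> a \<in> ?J" using a b DE(4) by (simp add: smult_assoc1)
    show "a \<otimes>\<^bsub>R\<^esub> b \<in> ?J" using a b by (simp add: smult_assoc1)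
  qed (rule R.ring_axioms)
  moreover have "S \<subseteq> ?J" using S gen by auto
  ultimately have "Idl\<^bsub>R\<^esub> S \<subseteq> ?J" by (rule R.genideal_minimal)
  then show ?thesis
    unfolding ideal_smult_def using D by (intro gen_submodule_minimal) auto
qed

lemma abelian_subgroup_submodule: "submodule K R M \<Longrightarrow> abelian_subgroup K M"
  by (intro abelian_subgroupI3 additive_subgroupI) (auto dest: submodule.axioms(1) simp: M.abelian_group_axioms)

lemma carrier_quot_module: "carrier (quot_module M K) = (\<lambda>x. K +>\<^bsub>M\<^esub> x) ` carrier M"
  by (auto simp: quot_module_def A_RCOSETS_def')

text \<open>
  Replacing \<open>x\<close> by \<open>k + x\<close> with \<open>k \<in> K\<close> changes \<open>a x\<close> by \<open>a k \<in> K\<close>, so all members of the union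
  that defines the scalar multiplication coincide.
\<close>

lemma quot_module_smult:
  assumes K: "submodule K R M" and "a \<in> carrier R" "x \<in> carrier M"
  shows "a \<odot>\<^bsub>quot_module M K\<^esub> (K +>\<^bsub>M\<^esub> x) = K +>\<^bsub>M\<^esub> (a \<odot>\<^bsub>M\<^esub> x)"
proof -
  interpret K: abelian_subgroup K M using K by (rule abelian_subgroup_submodule)
  note KE = submoduleE[OF K]
  have const: "K +>\<^bsub>M\<^esub> (a \<odot>\<^bsub>M\<^esub> y) = K +>\<^bsub>M\<^esub> (a \<odot>\<^bsub>M\<^esub> x)" if y: "y \<in> K +>\<^bsub>M\<^esub> x" for y
  proof -
    obtain k where k: "k \<in> K" "y = k \<oplus>\<^bsub>M\<^esub> x" using y by (auto simp: a_r_coset_def')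
    then have "a \<odot>\<^bsub>M\<^esub> y = a \<odot>\<^bsub>M\<^esub> k \<oplus>\<^bsub>M\<^esub> a \<odot>\<^bsub>M\<^esub> x" and c: "k \<in> carrier M"
      using assms KE(1) by (auto simp: smult_r_distr)
    then have "a \<odot>\<^bsub>M\<^esub> y \<in> K +>\<^bsub>M\<^esub> (a \<odot>\<^bsub>M\<^esub> x)"
      using KE(4)[OF assms(2) k(1)] by (auto simp: a_r_coset_def')
    then show ?thesis
      using assms by (intro K.a_repr_independence'[symmetric] smult_closed)
  qed
  have "K +>\<^bsub>M\<^esub> x \<noteq> {}"
    using K.a_rcos_self[OF assms(3)] by (metis empty_iff)
  from SUP_eq_const[OF this const] show ?thesis
    by (simp only: quot_module_def module.simps)
qed

lemma module_quot_module:
  assumes K: "submodule K R M"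
  shows "Module.module R (quot_module M K)"
proof -
  interpret K: abelian_subgroup K M using K by (rule abelian_subgroup_submodule)
  have [simp]: "add (quot_module M K) = set_add M" by (simp add: quot_module_def)
  have zero: "\<zero>\<^bsub>quot_module M K\<^esub> = K +>\<^bsub>M\<^esub> \<zero>\<^bsub>M\<^esub>"
    by (simp add: quot_module_def M.a_coset_add_zero K.a_subset)
  have "abelian_group (quot_module M K)"
  proof (rule abelian_groupI)
    fix A assume "A \<in> carrier (quot_module M K)"
    then obtain x where "x \<in> carrier M" "A = K +>\<^bsub>M\<^esub> x" by (auto simp: carrier_quot_module)
    then show "\<exists>B\<in>carrier (quot_module M K). B \<oplus>\<^bsub>quot_module M K\<^esub> A = \<zero>\<^bsub>quot_module M K\<^esub>"
      by (intro bexI[of _ "K +>\<^bsub>M\<^esub> (\<ominus>\<^bsub>M\<^esub> x)"]) (simp_all add: carrier_quot_module K.a_rcos_sum M.l_neg zero)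
  qed (auto simp: carrier_quot_module K.a_rcos_sum M.a_ac zero)
  then show ?thesis
    by (intro moduleI)
       (auto simp: R.cring_axioms carrier_quot_module quot_module_smult[OF K] K.a_rcos_sum
          smult_l_distr smult_r_distr smult_assoc1)
qed

text \<open>
  The canonical map \<open>M/K \<rightarrow> M/L\<close> is given on cosets, as sets, by adding \<open>L\<close>; this form avoids any choice
  of representatives.
\<close>

lemma quotient_map_in_module_hom:
  assumes K: "submodule K R M" and L: "submodule L R M" and "K \<subseteq> L"
  shows "(\<lambda>A. L <+>\<^bsub>M\<^esub> A) \<in> module_hom R (quot_module M K) (quot_module M L)"
    and "\<And>x. x \<in> carrier M \<Longrightarrow> L <+>\<^bsub>M\<^esub> (K +>\<^bsub>M\<^esub> x) = L +>\<^bsub>M\<^esub> x"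
proof -
  interpret K: abelian_subgroup K M using K by (rule abelian_subgroup_submodule)
  interpret L: abelian_subgroup L M using L by (rule abelian_subgroup_submodule)
  show eq: "L <+>\<^bsub>M\<^esub> (K +>\<^bsub>M\<^esub> x) = L +>\<^bsub>M\<^esub> x" if "x \<in> carrier M" for x
  proof (intro equalityI subsetI)
    fix z assume "z \<in> L <+>\<^bsub>M\<^esub> (K +>\<^bsub>M\<^esub> x)"
    then obtain l k where lk: "l \<in> L" "k \<in> K" "z = l \<oplus>\<^bsub>M\<^esub> (k \<oplus>\<^bsub>M\<^esub> x)"
      by (auto simp: set_add_def' a_r_coset_def')
    then have "z = (l \<oplus>\<^bsub>M\<^esub> k) \<oplus>\<^bsub>M\<^esub> x"
      using that K.a_subset L.a_subset by (simp add: M.a_assoc subsetD)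
    then show "z \<in> L +>\<^bsub>M\<^esub> x"
      using lk \<open>K \<subseteq> L\<close> by (auto simp: a_r_coset_def')
  next
    fix z assume "z \<in> L +>\<^bsub>M\<^esub> x"
    then obtain l where "l \<in> L" "z = l \<oplus>\<^bsub>M\<^esub> x" by (auto simp: a_r_coset_def')
    then show "z \<in> L <+>\<^bsub>M\<^esub> (K +>\<^bsub>M\<^esub> x)"
      using K.a_rcos_self[OF that] unfolding set_add_def' by blast
  qed
  show "(\<lambda>A. L <+>\<^bsub>M\<^esub> A) \<in> module_hom R (quot_module M K) (quot_module M L)"
    unfolding module_hom_def
  proof (intro CollectI conjI homI ballI)
    have ad: "add (quot_module M K) = set_add M" "add (quot_module M L) = set_add M"
      by (simp_all add: quot_module_def)
    show "L <+>\<^bsub>M\<^esub> (A \<otimes>\<^bsub>add_monoid (quot_module M K)\<^esub> B)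
        = (L <+>\<^bsub>M\<^esub> A) \<otimes>\<^bsub>add_monoid (quot_module M L)\<^esub> (L <+>\<^bsub>M\<^esub> B)"
      if "A \<in> carrier (add_monoid (quot_module M K))" "B \<in> carrier (add_monoid (quot_module M K))" for A B
      using that by (auto simp: carrier_quot_module ad K.a_rcos_sum L.a_rcos_sum eq)
  qed (auto simp: carrier_quot_module eq quot_module_smult K L)
qed

text \<open>
  The cosets of \<open>K\<close> in \<open>L\<close> are the same sets as the corresponding cosets in \<open>M\<close>, which is why the
  injection is the identity function.
\<close>

lemma short_exact_submodule_quotients:
  assumes K: "submodule K R M" and L: "submodule L R M" and "K \<subseteq> L"
  shows "short_exact_modules R (quot_module (M\<lparr>carrier := L\<rparr>) K) id
           (quot_module M K) (\<lambda>A. L <+>\<^bsub>M\<^esub> A) (quot_module M L)"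
proof -
  let ?L = "M\<lparr>carrier := L\<rparr>"
  interpret L: module R ?L using submodule.submodule_is_module[OF L] module_axioms .
  interpret La: abelian_subgroup L M using L by (rule abelian_subgroup_submodule)
  have Lc: "L \<subseteq> carrier M" by (rule La.a_subset)
  have [simp]: "K +>\<^bsub>?L\<^esub> x = K +>\<^bsub>M\<^esub> x" for x by (simp add: a_r_coset_def')
  have KL: "submodule K R ?L"
  proof (rule L.submoduleI)
    show "\<ominus>\<^bsub>?L\<^esub> a \<in> K" if "a \<in> K" for a
    proof -
      have "\<ominus>\<^bsub>M\<^esub> a \<in> K" using submoduleE(3)[OF K that] .
      moreover have "\<ominus>\<^bsub>?L\<^esub> a = \<ominus>\<^bsub>M\<^esub> a"
      proof (rule L.M.minus_equality)
      qed (use that calculation \<open>K \<subseteq> L\<close> Lc in \<open>auto simp: M.l_neg\<close>)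
      ultimately show ?thesis by simp
    qed
  qed (use K assms(3) submoduleE[OF K] subgroup.one_closed[OF submodule.axioms(1)[OF K]] in auto)
  have carL: "carrier (quot_module ?L K) = (\<lambda>x. K +>\<^bsub>M\<^esub> x) ` L"
    by (simp add: L.carrier_quot_module)
  have smultL: "a \<odot>\<^bsub>quot_module ?L K\<^esub> B = a \<odot>\<^bsub>quot_module M K\<^esub> B" for a B
    by (simp add: quot_module_def)
  have addL: "add (quot_module ?L K) = add (quot_module M K)"
    by (simp add: quot_module_def set_add_def' fun_eq_iff)
  have "id \<in> module_hom R (quot_module ?L K) (quot_module M K)"
    using Lc by (auto simp: module_hom_def hom_def smultL addL carL carrier_quot_module)
  moreover have "a_kernel (quot_module M K) (quot_module M L) (\<lambda>A. L <+>\<^bsub>M\<^esub> A) = (\<lambda>x. K +>\<^bsub>M\<^esub> x) ` L"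
  proof -
    have "L +>\<^bsub>M\<^esub> x = L \<longleftrightarrow> x \<in> L" if "x \<in> carrier M" for x
      using that by (metis La.a_rcos_self La.a_rcos_const)
    then show ?thesis
      using Lc by (auto simp: a_kernel_def kernel_def carrier_quot_module quotient_map_in_module_hom(2)[OF assms])
         (auto simp: quot_module_def quotient_map_in_module_hom(2)[OF assms])
  qed
  moreover have "(\<lambda>A. L <+>\<^bsub>M\<^esub> A) ` carrier (quot_module M K) = carrier (quot_module M L)"
    by (simp add: carrier_quot_module image_image quotient_map_in_module_hom(2)[OF assms])
  ultimately show ?thesis
    unfolding short_exact_modules_def
    by (simp add: module_quot_module L.module_quot_module K L KL quotient_map_in_module_hom(1)[OF assms] carL)
qed

end

section \<open>Commutators modulo a normal subgroup\<close>

text \<open>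
  The elements commuting with \<open>b\<close> form a subgroup.
\<close>

lemma (in group) commutes_with_generate:
  assumes "S \<subseteq> carrier G" "b \<in> carrier G" "\<And>a. a \<in> S \<Longrightarrow> a \<otimes> b = b \<otimes> a" "c \<in> generate G S"
  shows "c \<otimes> b = b \<otimes> c"
  using assms(4)
proof (induction c rule: generate.induct)
  case one
  show ?case using assms(2) by simp
next
  case (incl a)
  then show ?case by (rule assms(3))
next
  case (inv a)
  have a: "a \<in> carrier G" using inv assms(1) by auto
  have "inv a \<otimes> (a \<otimes> b) \<otimes> inv a = inv a \<otimes> (b \<otimes> a) \<otimes> inv a"
    using assms(3)[OF inv] by simp
  then show ?case using a assms(2) by (simp add: m_assoc) (simp add: inv_solve_left' flip: m_assoc)
next
  case (eng c c')
  have "c \<in> carrier G" "c' \<in> carrier G"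
    using eng generate_in_carrier[OF assms(1)] by auto
  then show ?case using eng assms(2) by (metis m_assoc)
qed

lemma (in group) commutator_eq_one_iff:
  assumes "a \<in> carrier G" "b \<in> carrier G"
  shows "a \<otimes> b \<otimes> inv a \<otimes> inv b = \<one> \<longleftrightarrow> a \<otimes> b = b \<otimes> a"
proof -
  have "a \<otimes> b \<otimes> inv a \<otimes> inv b = (a \<otimes> b) \<otimes> inv (b \<otimes> a)"
    using assms by (simp add: inv_mult_group m_assoc)
  then show ?thesis using assms by (metis inv_closed inv_comm inv_equality inv_inv m_closed r_inv)
qed

text \<open>
  In \<open>G/K\<close> the images of the generators commute. Applying the centralizer argument
  in each of the two arguments of the commutator shows that the whole image of the generated subgroup
  is abelian.
\<close>

lemma (in group) derived_generate_subset_normal: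
  assumes K: "K \<lhd> G" and S: "S \<subseteq> carrier G"
    and comm: "\<And>a b. \<lbrakk>a \<in> S; b \<in> S\<rbrakk> \<Longrightarrow> a \<otimes> b \<otimes> inv a \<otimes> inv b \<in> K"
  shows "derived G (generate G S) \<subseteq> K"
proof -
  interpret K: normal K G by (rule K)
  interpret Q: group "G Mod K" by (rule K.factorgroup_is_group)
  define \<phi> where "\<phi> a = K #> a" for a
  interpret h: group_hom G "G Mod K" \<phi>
    unfolding \<phi>_def by unfold_locales (rule K.r_coset_hom_Mod)
  have inK: "c \<in> K \<longleftrightarrow> \<phi> c = \<one>\<^bsub>G Mod K\<^esub>" if "c \<in> carrier G" for c
    using that K.subgroup_axioms coset_join1[OF _ that K.subgroup_axioms] coset_join2[OF that K.subgroup_axioms]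
    by (auto simp: \<phi>_def FactGroup_def)
  have iff: "a \<otimes> b \<otimes> inv a \<otimes> inv b \<in> K \<longleftrightarrow> \<phi> a \<otimes>\<^bsub>G Mod K\<^esub> \<phi> b = \<phi> b \<otimes>\<^bsub>G Mod K\<^esub> \<phi> a"
    if "a \<in> carrier G" "b \<in> carrier G" for a b
    using that Q.commutator_eq_one_iff[of "\<phi> a" "\<phi> b"] by (simp add: inK)
  have gen: "generate G S \<subseteq> carrier G" by (rule generate_incl[OF S])
  have commute: "\<phi> c \<otimes>\<^bsub>G Mod K\<^esub> \<phi> b = \<phi> b \<otimes>\<^bsub>G Mod K\<^esub> \<phi> c"
    if b: "b \<in> carrier G" and S_b: "\<And>a. a \<in> S \<Longrightarrow> \<phi> a \<otimes>\<^bsub>G Mod K\<^esub> \<phi> b = \<phi> b \<otimes>\<^bsub>G Mod K\<^esub> \<phi> a"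
      and c: "c \<in> generate G S" for b c
  proof (rule Q.commutes_with_generate)
    show "\<phi> ` S \<subseteq> carrier (G Mod K)" using S h.hom_closed by blast
    show "\<phi> b \<in> carrier (G Mod K)" using b by (rule h.hom_closed)
    show "\<phi> c \<in> generate (G Mod K) (\<phi> ` S)" using imageI[OF c, of \<phi>] by (simp only: h.generate_img[OF S])
    show "x \<otimes>\<^bsub>G Mod K\<^esub> \<phi> b = \<phi> b \<otimes>\<^bsub>G Mod K\<^esub> x" if x: "x \<in> \<phi> ` S" for x
    proof -
      obtain a where a: "a \<in> S" "x = \<phi> a" using x by blast
      show ?thesis unfolding a(2) by (rule S_b[OF a(1)])
    qed
  qed
  have S_gen: "\<phi> c \<otimes>\<^bsub>G Mod K\<^esub> \<phi> b = \<phi> b \<otimes>\<^bsub>G Mod K\<^esub> \<phi> c" if b: "b \<in> S" and c: "c \<in> generate G S" for b c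
  proof (rule commute[OF subsetD[OF S b] _ c])
    fix a assume a: "a \<in> S"
    show "\<phi> a \<otimes>\<^bsub>G Mod K\<^esub> \<phi> b = \<phi> b \<otimes>\<^bsub>G Mod K\<^esub> \<phi> a"
      by (rule iffD1[OF iff[OF subsetD[OF S a] subsetD[OF S b]] comm[OF a b]])
  qed
  have "a \<otimes> b \<otimes> inv a \<otimes> inv b \<in> K" if a: "a \<in> generate G S" and b: "b \<in> generate G S" for a b
  proof (rule iffD2[OF iff[OF subsetD[OF gen a] subsetD[OF gen b]]])
    show "\<phi> a \<otimes>\<^bsub>G Mod K\<^esub> \<phi> b = \<phi> b \<otimes>\<^bsub>G Mod K\<^esub> \<phi> a"
      by (rule commute[OF subsetD[OF gen b] S_gen[OF _ b, symmetric] a])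
  qed
  then have "derived_set G (generate G S) \<subseteq> K"
    by (intro UN_least) simp
  then show ?thesis
    unfolding derived_def by (rule generate_subgroup_incl[OF _ K.subgroup_axioms])
qed

text \<open>
  Hence conjugation acts on the cosets of a normal subgroup through representatives, which describes the
  action on the abelianization.
\<close>

lemma (in group) conj_image_coset:
  assumes "D \<lhd> G" "s \<in> carrier G" "h \<in> carrier G"
  shows "(\<lambda>k. s \<otimes> k \<otimes> inv s) ` (D #> h) = D #> (s \<otimes> h \<otimes> inv s)"
proof -
  interpret D: normal D G by fact
  have D: "d \<in> carrier G" if "d \<in> D" for d using that D.subset by auto
  show ?thesis
  proof (intro equalityI subsetI)
    fix z assume "z \<in> (\<lambda>k. s \<otimes> k \<otimes> inv s) ` (D #> h)"
    then obtain e where e: "e \<in> D" "z = s \<otimes> (e \<otimes> h) \<otimes> inv s" by (auto simp: r_coset_def)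
    have "z = (s \<otimes> e \<otimes> inv s) \<otimes> (s \<otimes> h \<otimes> inv s)"
      using e assms D by (simp add: m_assoc) (simp flip: m_assoc)
    then show "z \<in> D #> (s \<otimes> h \<otimes> inv s)"
      using D.inv_op_closed2[OF assms(2) e(1)] by (auto simp: r_coset_def)
  next
    fix z assume "z \<in> D #> (s \<otimes> h \<otimes> inv s)"
    then obtain e where e: "e \<in> D" "z = e \<otimes> (s \<otimes> h \<otimes> inv s)" by (auto simp: r_coset_def)
    have "z = s \<otimes> ((inv s \<otimes> e \<otimes> s) \<otimes> h) \<otimes> inv s"
      using e assms D by (simp add: m_assoc) (simp flip: m_assoc)
    then show "z \<in> (\<lambda>k. s \<otimes> k \<otimes> inv s) ` (D #> h)"
      using D.inv_op_closed1[OF assms(2) e(1)] by (auto simp: r_coset_def)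
  qed
qed

section \<open>The kernel as a module\<close>

locale Zpow_extension = group G for G (structure) +
  fixes d :: nat and P :: "'a \<Rightarrow> (nat \<Rightarrow>\<^sub>0 int)"
  assumes P_hom: "P \<in> hom G (Zpow d)"
    and P_surj: "P ` carrier G = carrier (Zpow d)"
    and comm_group_kernel: "comm_group (G\<lparr>carrier := kernel G (Zpow d) P\<rparr>)"
begin

sublocale P: group_hom G "Zpow d" P
  by (intro group_hom.intro group_hom_axioms.intro is_group group_free_Abelian_group P_hom)

abbreviation ker where "ker \<equiv> kernel G (Zpow d) P"

definition lift where "lift v = inv_into (carrier G) P v"

lemma lift: "v \<in> carrier (Zpow d) \<Longrightarrow> lift v \<in> carrier G" "v \<in> carrier (Zpow d) \<Longrightarrow> P (lift v) = v"
  unfolding lift_def using P_surj by (metis inv_into_into) (metis P_surj f_inv_into_f)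

abbreviation "conj_act v y \<equiv> (let x = inv_into (carrier G) P v in x \<otimes> y \<otimes> inv x)"

lemma conj_act_closed: "\<lbrakk>v \<in> carrier (Zpow d); y \<in> ker\<rbrakk> \<Longrightarrow> conj_act v y \<in> ker"
  using normal.inv_op_closed2[OF P.normal_kernel] lift by (simp add: Let_def lift_def del: carrier_free_Abelian_group_iff)

text \<open>
  Two lifts of the same exponent vector differ by an element of the abelian kernel, so every lift
  computes the action.
\<close>

lemma conj_act_eq:
  assumes x: "x \<in> carrier G" and y: "y \<in> ker"
  shows "conj_act (P x) y = x \<otimes> y \<otimes> inv x"
proof -
  have "conj_act (P x) y \<in> carrier (G\<lparr>carrier := ker\<rparr>)"
    using conj_act_closed[OF P.hom_closed[OF x] y] by simp
  from smult_laurent_module_monom[where act = conj_act, OF comm_group_kernel this]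
    smult_kernel_module[OF is_group P_hom comm_group_kernel x refl y]
  show ?thesis by (simp only: kernel_module_def)
qed

sublocale N: laurent_action "G\<lparr>carrier := ker\<rparr>" d conj_act
proof (intro laurent_action.intro laurent_action_axioms.intro comm_group_kernel)
  note [simp del] = carrier_free_Abelian_group_iff
  have kc: "y \<in> carrier G" if "y \<in> ker" for y using that by (simp add: kernel_def)
  show "conj_act v \<in> hom (G\<lparr>carrier := ker\<rparr>) (G\<lparr>carrier := ker\<rparr>)" if "v \<in> carrier (Zpow d)" for v
    using conj_act_closed[OF that] lift[OF that] kc
    by (intro homI) (simp_all add: Let_def m_assoc inv_solve_left flip: lift_def)
  show "conj_act 0 y = y" if "y \<in> carrier (G\<lparr>carrier := ker\<rparr>)" for y
    using that conj_act_eq[of \<one> y] kc[of y] by simp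
  show "conj_act (u + v) y = conj_act u (conj_act v y)"
    if uv: "u \<in> carrier (Zpow d)" "v \<in> carrier (Zpow d)" and y: "y \<in> carrier (G\<lparr>carrier := ker\<rparr>)" for u v y
  proof -
    have y: "y \<in> ker" "y \<in> carrier G" using y kc by auto
    have "P (lift u \<otimes> lift v) = u + v" using lift uv by simp
    then have "conj_act (u + v) y = (lift u \<otimes> lift v) \<otimes> y \<otimes> inv (lift u \<otimes> lift v)"
      using conj_act_eq[of "lift u \<otimes> lift v" y] lift uv y by simp
    also have "\<dots> = conj_act u (conj_act v y)"
      using lift uv y by (simp add: Let_def inv_mult_group m_assoc flip: lift_def)
    finally show ?thesis .
  qed
qed

abbreviation "\<Lambda> \<equiv> laurent_ring d"
abbreviation "N \<equiv> kernel_module G d P"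

lemma kernel_module_eq: "N = laurent_module (G\<lparr>carrier := ker\<rparr>) conj_act"
  by (simp add: kernel_module_def)

lemma module_kernel_module: "Module.module \<Lambda> N"
  unfolding kernel_module_eq by (rule N.module_laurent_module)

lemma carrier_kernel_module: "carrier N = ker"
  by (simp add: kernel_module_def laurent_module_def)

lemma a_r_coset_kernel_module: "K +>\<^bsub>N\<^esub> y = K #> y"
  by (simp add: kernel_module_def laurent_module_def a_r_coset_def')
     (simp add: r_coset_def)

text \<open>
  Every element of \<open>G\<close> is a lift of its image under \<open>P\<close>, so stability under all monomials is the
  same as invariance under all conjugations.
\<close>

lemma submodule_kernel_module_iff: "submodule K \<Lambda> N \<longleftrightarrow> K \<lhd> G \<and> K \<subseteq> ker"
proof
  note [simp del] = carrier_free_Abelian_group_iff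
  assume K: "submodule K \<Lambda> N"
  note K = N.submodule_laurentD[OF K[unfolded kernel_module_eq]]
  have sub: "K \<subseteq> ker" using subgroup.subset[OF K(1)] by simp
  have "subgroup K G"
    using incl_subgroup[OF P.subgroup_kernel K(1)] .
  moreover have "x \<otimes> k \<otimes> inv x \<in> K" if "x \<in> carrier G" "k \<in> K" for x k
    using K(2)[of "P x" k] that sub conj_act_eq[of x k] by (simp only: P.hom_closed subsetD)
  ultimately show "K \<lhd> G \<and> K \<subseteq> ker" using sub by (simp add: normal_inv_iff)
next
  assume K: "K \<lhd> G \<and> K \<subseteq> ker"
  show "submodule K \<Lambda> N"
    unfolding kernel_module_eq
  proof (rule N.submodule_laurentI)
    show "subgroup K (G\<lparr>carrier := ker\<rparr>)"
      using K by (intro subgroup_incl normal_imp_subgroup P.subgroup_kernel) auto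
    show "conj_act v k \<in> K" if "v \<in> carrier (Zpow d)" "k \<in> K" for v k
      using K that normal.inv_op_closed2[of K G "lift v" k] lift[OF that(1)]
      by (simp only: Let_def lift_def)
  qed
qed

text \<open>
  This is where the ideal \<open>I\<close> meets commutators: \<open>(t - 1) y = [x, y]\<close>.
\<close>

lemma smult_monom_minus_one:
  assumes "x \<in> carrier G" "y \<in> ker"
  shows "(laurent_monom (P x) - 1) \<odot>\<^bsub>N\<^esub> y = x \<otimes> y \<otimes> inv x \<otimes> inv y"
proof -
  note [simp del] = carrier_free_Abelian_group_iff
  have 0: "0 \<in> carrier (Zpow d)" by (simp add: carrier_free_Abelian_group_iff)
  have "(laurent_monom (P x) - laurent_monom 0) \<odot>\<^bsub>N\<^esub> y
      = (laurent_monom (P x) \<odot>\<^bsub>N\<^esub> y) \<otimes>\<^bsub>G\<lparr>carrier := ker\<rparr>\<^esub> inv\<^bsub>G\<lparr>carrier := ker\<rparr>\<^esub> (laurent_monom 0 \<odot>\<^bsub>N\<^esub> y)"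
    unfolding kernel_module_eq
    using assms 0
    by (intro N.smult_diff laurent_monom_in_carrier P.hom_closed) simp_all
  also have "laurent_monom (P x) \<odot>\<^bsub>N\<^esub> y = x \<otimes> y \<otimes> inv x"
    using assms smult_kernel_module[OF is_group P_hom comm_group_kernel] by simp
  also have "laurent_monom 0 \<odot>\<^bsub>N\<^esub> y = y"
    unfolding kernel_module_eq using N.smult_monom[OF 0, of y] N.act_zero[of y] assms by simp
  also have "inv\<^bsub>G\<lparr>carrier := ker\<rparr>\<^esub> y = inv y"
    using m_inv_consistent[OF P.subgroup_kernel] assms by simp
  finally show ?thesis by simp
qed

lemma commutator_in_kernel:
  assumes "a \<in> carrier G" "b \<in> carrier G"
  shows "a \<otimes> b \<otimes> inv a \<otimes> inv b \<in> ker"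
proof -
  interpret Z: comm_group "Zpow d" by (rule abelian_free_Abelian_group)
  have "P (a \<otimes> b \<otimes> inv a \<otimes> inv b)
      = P a \<otimes>\<^bsub>Zpow d\<^esub> P b \<otimes>\<^bsub>Zpow d\<^esub> inv\<^bsub>Zpow d\<^esub> P a \<otimes>\<^bsub>Zpow d\<^esub> inv\<^bsub>Zpow d\<^esub> P b"
    using assms by (simp only: P.hom_mult P.hom_inv m_closed inv_closed)
  also have "\<dots> = \<one>\<^bsub>Zpow d\<^esub>"
    using assms by (intro iffD2[OF P.H.commutator_eq_one_iff] Z.m_comm P.hom_closed)
  finally show ?thesis using assms by (simp add: kernel_def)
qed

end

context Zpow_extension
begin

lemma kernel_in_carrier: "y \<in> ker \<Longrightarrow> y \<in> carrier G"
  by (simp add: kernel_def)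

lemma P_conj:
  assumes "g \<in> carrier G" "h \<in> carrier G"
  shows "P (g \<otimes> h \<otimes> inv g) = P h"
proof -
  have "g \<otimes> h \<otimes> inv g = (g \<otimes> h \<otimes> inv g \<otimes> inv h) \<otimes> h"
    using assms by (simp add: m_assoc)
  also have "P \<dots> = P (g \<otimes> h \<otimes> inv g \<otimes> inv h) \<otimes>\<^bsub>Zpow d\<^esub> P h"
    using assms by (intro P.hom_mult) simp_all
  also have "\<dots> = P h"
    using commutator_in_kernel[OF assms] by (simp only: kernel_def) simp
  finally show ?thesis .
qed

text \<open>
  The image under \<open>P\<close> of the subgroup generated by the \<open>x\<^sub>i\<close> contains all integral combinations
  of the \<open>t\<^sub>i\<close>; adding the kernel to the generators turns this into a statement about elements
  of \<open>G\<close>.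
\<close>

lemma generate_preimage:
  assumes x: "\<And>i. i < n \<Longrightarrow> x i \<in> carrier G \<and> P (x i) = t i"
    and h: "h \<in> carrier G" "P h \<in> Z_lincomb n t ` carrier (Zpow n)"
  shows "h \<in> generate G (ker \<union> x ` {..<n})"
proof -
  let ?L = "generate G (ker \<union> x ` {..<n})"
  have "ker \<union> x ` {..<n} \<subseteq> carrier G" using x kernel_in_carrier by auto
  then interpret L: subgroup ?L G by (rule generate_is_subgroup)
  have PL: "subgroup (P ` ?L) (Zpow d)"
    using L.subgroup_axioms by (rule P.subgroup_img_is_subgroup)
  interpret PL: subgroup "P ` ?L" "Zpow d" by (rule PL)
  have t: "t i \<in> P ` ?L" if "i < n" for i
  proof -
    have "x i \<in> ?L" using that by (intro generate.incl) auto
    then show ?thesis using x[OF that] by (metis imageI)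
  qed
  have "frag_cmul k (t i) \<in> P ` ?L" if "i < n" for k i
    using group.subgroup_int_pow_closed[OF group_free_Abelian_group PL t[OF that], of k]
      PL.mem_carrier[OF t[OF that]] by simp
  then have span: "(\<Sum>i<m. frag_cmul (Poly_Mapping.lookup c i) (t i)) \<in> P ` ?L" if "m \<le> n" for c m
    using that
  proof (induction m)
    case 0
    show ?case using PL.one_closed by simp
  next
    case (Suc m)
    then show ?case
      using PL.m_closed[of "\<Sum>i<m. frag_cmul (Poly_Mapping.lookup c i) (t i)" "frag_cmul (Poly_Mapping.lookup c m) (t m)"]
      by simp
  qed
  obtain c where "P h = (\<Sum>i<n. frag_cmul (Poly_Mapping.lookup c i) (t i))"
    using h(2) unfolding Z_lincomb_def by (elim imageE)
  then have "P h \<in> P ` ?L" using span[of n c] by simp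
  then obtain l where l: "l \<in> ?L" "P l = P h" by (metis imageE)
  obtain y where y: "y \<in> ker" "h = l \<otimes> y"
    using conj_mult_kernel[OF is_group group_free_Abelian_group P_hom L.mem_carrier[OF l(1)] h(1) l(2)] by blast
  have "y \<in> ?L" using y(1) by (intro generate.incl) simp
  then show ?thesis using l(1) y(2) L.m_closed by simp
qed

end

section \<open>The derived subgroup of the preimage\<close>

locale Zpow_extension_basis = Zpow_extension +
  fixes n :: nat and Z :: "(nat \<Rightarrow>\<^sub>0 int) set" and t :: "nat \<Rightarrow> (nat \<Rightarrow>\<^sub>0 int)" and x :: "nat \<Rightarrow> 'a"
  assumes Z_subgroup: "subgroup Z (Zpow d)"
    and basis: "Z_basis n t Z"
    and x: "\<And>i. i < n \<Longrightarrow> x i \<in> carrier G \<and> P (x i) = t i"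
begin

definition H where "H = {h \<in> carrier G. P h \<in> Z}"

lemma H_carrier: "h \<in> H \<Longrightarrow> h \<in> carrier G"
  by (simp add: H_def)

lemma H_normal: "H \<lhd> G"
  unfolding normal_inv_iff
proof (intro conjI ballI)
  interpret Z: subgroup Z "Zpow d" by (rule Z_subgroup)
  show "subgroup H G"
  proof (rule subgroup.intro)
    show "\<one> \<in> H" using Z.one_closed P.hom_one by (simp add: H_def)
    show "inv a \<in> H" if "a \<in> H" for a
      using that Z.m_inv_closed[of "P a"] P.hom_inv[of a] by (simp only: H_def mem_Collect_eq inv_closed)
    show "a \<otimes> b \<in> H" if "a \<in> H" "b \<in> H" for a b
      using that Z.m_closed[of "P a" "P b"] P.hom_mult[of a b] by (simp only: H_def mem_Collect_eq m_closed)
  qed (auto simp: H_def)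
  fix g h assume g: "g \<in> carrier G" and h: "h \<in> H"
  then show "g \<otimes> h \<otimes> inv g \<in> H"
    using P_conj[OF g, of h] by (simp only: H_def mem_Collect_eq m_closed inv_closed)
qed

lemma H_subgroup: "subgroup H G"
  using H_normal by (rule normal_imp_subgroup)

lemma ker_subset_H: "ker \<subseteq> H"
  using subgroup.one_closed[OF Z_subgroup] by (auto simp: H_def kernel_def)

abbreviation "D \<equiv> derived G H"

lemma D_normal: "D \<lhd> G"
  by (rule derived_is_normal[OF H_normal])

lemma D_subset_ker: "D \<subseteq> ker"
  unfolding derived_def
proof (rule generate_subgroup_incl[OF _ P.subgroup_kernel])
  show "derived_set G H \<subseteq> ker"
    by (intro UN_least) (simp add: commutator_in_kernel H_carrier)
qed

lemma D_submodule: "submodule D \<Lambda> N"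
  using D_normal D_subset_ker by (simp add: submodule_kernel_module_iff)

lemma commutator_in_D: "\<lbrakk>a \<in> H; b \<in> H\<rbrakk> \<Longrightarrow> a \<otimes> b \<otimes> inv a \<otimes> inv b \<in> D"
  unfolding derived_def by (intro generate.incl UN_I[of a] UN_I[of b]) simp_all

lemma t_in_Z: "i < n \<Longrightarrow> t i \<in> Z"
proof -
  assume i: "i < n"
  have "Z_lincomb n t (frag_of i) = (\<Sum>j<n. if j = i then t j else 0)"
    unfolding Z_lincomb_def by (intro sum.cong) auto
  also have "\<dots> = t i" using i by (simp add: sum.delta)
  finally have "t i = Z_lincomb n t (frag_of i)" ..
  moreover have "frag_of i \<in> carrier (Zpow n)" using i by simp
  ultimately show ?thesis using basis unfolding Z_basis_def by blast
qed

lemma x_in_H: "i < n \<Longrightarrow> x i \<in> H"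
  using x[of i] t_in_Z[of i] by (simp add: H_def)

lemma H_generate: "H = generate G (ker \<union> x ` {..<n})"
proof
  show "H \<subseteq> generate G (ker \<union> x ` {..<n})"
    using generate_preimage[OF x] basis by (auto simp: H_def Z_basis_def)
  show "generate G (ker \<union> x ` {..<n}) \<subseteq> H"
    using ker_subset_H x_in_H by (intro generate_subgroup_incl H_subgroup) auto
qed

definition I where "I = Idl\<^bsub>\<Lambda>\<^esub> {laurent_monom (t i) - 1 | i. i < n}"

definition C where
  "C = gen_submodule \<Lambda> N {x i \<otimes> x j \<otimes> inv (x i) \<otimes> inv (x j) | i j. i < j \<and> j < n}"

abbreviation "IN \<equiv> ideal_smult \<Lambda> N I"

lemma I_generators: "{laurent_monom (t i) - 1 | i. i < n} \<subseteq> carrier \<Lambda>"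
proof -
  have "laurent_monom (t i) - laurent_monom 0 \<in> carrier \<Lambda>" if "i < n" for i
    using x[OF that] P.hom_closed[of "x i"]
    by (intro diff_in_laurent_ring laurent_monom_in_carrier) auto
  then show ?thesis by auto
qed

lemma I_subset: "I \<subseteq> carrier \<Lambda>"
proof -
  interpret L: cring \<Lambda> by (rule cring_laurent_ring)
  show ?thesis
    using ideal.Icarr[OF L.genideal_ideal[OF I_generators]] unfolding I_def by blast
qed

lemma monom_minus_one_in_I: "i < n \<Longrightarrow> laurent_monom (t i) - 1 \<in> I"
proof -
  assume "i < n"
  interpret L: cring \<Lambda> by (rule cring_laurent_ring)
  show ?thesis
    unfolding I_def using \<open>i < n\<close> by (intro subsetD[OF L.genideal_self[OF I_generators]]) blast
qed

lemma C_generators: "{x i \<otimes> x j \<otimes> inv (x i) \<otimes> inv (x j) | i j. i < j \<and> j < n} \<subseteq> carrier N"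
proof -
  have "x i \<otimes> x j \<otimes> inv (x i) \<otimes> inv (x j) \<in> carrier N" if "i < j" "j < n" for i j
    unfolding carrier_kernel_module using that x by (intro commutator_in_kernel) auto
  then show ?thesis by blast
qed

lemma C_submodule: "submodule C \<Lambda> N"
  unfolding C_def by (rule module.submodule_gen_submodule[OF module_kernel_module C_generators])

lemma IN_submodule: "submodule IN \<Lambda> N"
  by (rule module.submodule_ideal_smult[OF module_kernel_module I_subset])

text \<open>
  The heart of the matter. Only commutators \<open>[x\<^sub>i, x\<^sub>j]\<close> with \<open>i < j\<close> generate \<open>C\<close>; those with
  \<open>i > j\<close> are their inverses.
\<close>

lemma derived_preimage: "D = C <+>\<^bsub>N\<^esub> IN"
proof
  interpret KM: module \<Lambda> N by (rule module_kernel_module)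
  let ?K = "C <+>\<^bsub>N\<^esub> IN"
  have K: "submodule ?K \<Lambda> N" by (rule KM.submodule_set_add[OF C_submodule IN_submodule])
  then have "?K \<lhd> G" by (simp add: submodule_kernel_module_iff)
  then interpret K: normal ?K G .
  have CK: "C \<subseteq> ?K" and IK: "IN \<subseteq> ?K"
    using KM.subset_set_add[OF C_submodule IN_submodule] by auto
  have xy: "x i \<otimes> y \<otimes> inv (x i) \<otimes> inv y \<in> ?K" if i: "i < n" and y: "y \<in> ker" for i y
  proof -
    have "(laurent_monom (t i) - 1) \<odot>\<^bsub>N\<^esub> y \<in> IN"
      using KM.ideal_smult_incl[OF monom_minus_one_in_I[OF i]] y by (simp add: carrier_kernel_module)
    moreover have "(laurent_monom (t i) - 1) \<odot>\<^bsub>N\<^esub> y = x i \<otimes> y \<otimes> inv (x i) \<otimes> inv y"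
      using smult_monom_minus_one[of "x i" y] x[OF i] y by simp
    ultimately show ?thesis using IK by auto
  qed
  have xx: "x i \<otimes> x j \<otimes> inv (x i) \<otimes> inv (x j) \<in> ?K" if "i < j" "j < n" for i j
  proof -
    have "x i \<otimes> x j \<otimes> inv (x i) \<otimes> inv (x j) \<in> C"
      unfolding C_def using that by (intro subsetD[OF KM.gen_submodule_incl]) blast
    then show ?thesis using CK by auto
  qed
  have swap: "b \<otimes> a \<otimes> inv b \<otimes> inv a \<in> ?K"
    if "a \<otimes> b \<otimes> inv a \<otimes> inv b \<in> ?K" "a \<in> carrier G" "b \<in> carrier G" for a b
    using K.m_inv_closed[OF that(1)] that(2,3) by (simp add: inv_mult_group m_assoc)
  have "a \<otimes> b \<otimes> inv a \<otimes> inv b \<in> ?K"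
    if ab: "a \<in> ker \<union> x ` {..<n}" "b \<in> ker \<union> x ` {..<n}" for a b
  proof -
    consider "a \<in> ker" "b \<in> ker" | i where "i < n" "a = x i" "b \<in> ker"
      | j where "a \<in> ker" "j < n" "b = x j" | i j where "i < n" "j < n" "a = x i" "b = x j"
      using ab by blast
    then show ?thesis
    proof cases
      case 1
      have "a \<otimes> b = b \<otimes> a" using N.m_comm[of a b] 1 by simp
      then have "a \<otimes> b \<otimes> inv a \<otimes> inv b = \<one>"
        using 1 by (intro iffD2[OF commutator_eq_one_iff] kernel_in_carrier)
      then show ?thesis using K.one_closed by simp
    next
      case 2
      then show ?thesis using xy by simp
    next
      case 3
      then show ?thesis using swap[OF xy[of j a]] x kernel_in_carrier by simp
    next
      case 4
      have c: "x i \<in> carrier G" "x j \<in> carrier G" using 4 x by auto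
      consider "i < j" | "i = j" | "j < i" by linarith
      then show ?thesis
      proof cases
        case 1
        then show ?thesis using 4 xx by simp
      next
        case 2
        then have "x i \<otimes> x j \<otimes> inv (x i) \<otimes> inv (x j) = \<one>"
          using c by (intro iffD2[OF commutator_eq_one_iff]) simp_all
        then show ?thesis using 4 K.one_closed by simp
      next
        case 3
        then show ?thesis using 4 swap[OF xx[of j i]] c by simp
      qed
    qed
  qed
  moreover have "ker \<union> x ` {..<n} \<subseteq> carrier G"
    using x kernel_in_carrier by auto
  ultimately show "D \<subseteq> ?K"
    unfolding H_generate using \<open>?K \<lhd> G\<close> by (intro derived_generate_subset_normal)
  show "?K \<subseteq> D"
  proof (rule KM.set_add_subset[OF D_submodule])
    show "C \<subseteq> D"
      unfolding C_def
    proof (rule KM.gen_submodule_minimal[OF D_submodule])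
      show "{x i \<otimes> x j \<otimes> inv (x i) \<otimes> inv (x j) | i j. i < j \<and> j < n} \<subseteq> D"
        using commutator_in_D x_in_H by auto
    qed
    show "IN \<subseteq> D"
      unfolding I_def
    proof (rule KM.ideal_smult_genideal_subset[OF D_submodule I_generators])
      fix s y assume s: "s \<in> {laurent_monom (t i) - 1 | i. i < n}" and y: "y \<in> carrier N"
      then obtain i where i: "i < n" "s = laurent_monom (t i) - 1" by blast
      have "s \<odot>\<^bsub>N\<^esub> y = x i \<otimes> y \<otimes> inv (x i) \<otimes> inv y"
        using smult_monom_minus_one[of "x i" y] x[OF i(1)] y i(2) by (simp add: carrier_kernel_module)
      then show "s \<odot>\<^bsub>N\<^esub> y \<in> D"
        using commutator_in_D[OF x_in_H[OF i(1)]] y ker_subset_H by (auto simp: carrier_kernel_module)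
    qed
  qed
qed

end

section \<open>The abelianization as a module\<close>

lemma laurent_action_trivial: "laurent_action (Zpow n) d (\<lambda>v z. z)"
  by (intro laurent_action.intro laurent_action_axioms.intro abelian_free_Abelian_group)
     (auto simp: hom_def simp del: carrier_free_Abelian_group_iff)

lemma Z_lincomb_diff: "Z_lincomb n t (c - c') = Z_lincomb n t c - Z_lincomb n t c'"
proof -
  have "frag_cmul (k - l) u = frag_cmul k u - frag_cmul l u" for k l and u :: "nat \<Rightarrow>\<^sub>0 int"
    by (intro poly_mapping_eqI) (simp add: lookup_minus left_diff_distrib)
  then show ?thesis by (simp add: Z_lincomb_def lookup_minus sum_subtractf)
qed

context Zpow_extension_basis
begin

abbreviation "Hab \<equiv> abelianization (G\<lparr>carrier := H\<rparr>)"

lemma Hab_eq: "carrier Hab = (\<lambda>h. D #> h) ` H" "monoid.mult Hab = (<#>)"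
  using derived_consistent[OF order.refl H_subgroup]
  by (simp_all add: abelianization_def FactGroup_def RCOSETS_def r_coset_def set_mult_def fun_eq_iff image_def)
     blast

lemma Hab_cases:
  assumes "A \<in> carrier Hab"
  obtains h where "h \<in> H" "A = D #> h"
  using assms unfolding Hab_eq by (elim imageE)

lemma comm_group_Hab: "comm_group Hab"
  unfolding abelianization_def
  by (intro group.derived_quot_is_comm_group subgroup.subgroup_is_group[OF H_subgroup] is_group)

lemma Hab_mult: "\<lbrakk>h \<in> H; k \<in> H\<rbrakk> \<Longrightarrow> (D #> h) \<otimes>\<^bsub>Hab\<^esub> (D #> k) = D #> (h \<otimes> k)"
  using normal.rcos_sum[OF D_normal] by (simp add: Hab_eq H_carrier)

abbreviation "conj_coset v A \<equiv> (let x = inv_into (carrier G) P v in (\<lambda>h. x \<otimes> h \<otimes> inv x) ` A)"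

lemma conj_H: "\<lbrakk>g \<in> carrier G; h \<in> H\<rbrakk> \<Longrightarrow> g \<otimes> h \<otimes> inv g \<in> H"
  by (rule normal.inv_op_closed2[OF H_normal])

lemma conj_coset_lift: "\<lbrakk>v \<in> carrier (Zpow d); h \<in> H\<rbrakk> \<Longrightarrow> conj_coset v (D #> h) = D #> (lift v \<otimes> h \<otimes> inv (lift v))"
  using conj_image_coset[OF D_normal lift(1) H_carrier] by (simp only: Let_def flip: lift_def)

lemma abelianization_module_eq: "abelianization_module G P H = laurent_module Hab conj_coset"
  by (simp only: abelianization_module_def)

text \<open>
  Two lifts differ by an element of \<open>N \<subseteq> H\<close>, and \<open>H\<close> acts trivially on its abelianization by
  conjugation; so any lift may be used.
\<close>

lemma conj_coset_eq:
  assumes g: "g \<in> carrier G" and h: "h \<in> H"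
  shows "conj_coset (P g) (D #> h) = D #> (g \<otimes> h \<otimes> inv g)"
proof -
  have "conj_coset (P g) (D #> h) \<in> carrier Hab"
    using conj_coset_lift[OF P.hom_closed[OF g] h] conj_H[OF lift(1)[OF P.hom_closed[OF g]] h]
    by (simp only: Hab_eq) blast
  from smult_laurent_module_monom[where act = conj_coset, OF comm_group_Hab this]
    smult_abelianization_module[OF is_group P_hom Z_subgroup H_def g refl h]
  show ?thesis by (simp only: abelianization_module_eq)
qed

sublocale Hab: laurent_action Hab d conj_coset
proof (intro laurent_action.intro laurent_action_axioms.intro comm_group_Hab)
  note [simp del] = carrier_free_Abelian_group_iff
  show "conj_coset v \<in> hom Hab Hab" if v: "v \<in> carrier (Zpow d)" for v
  proof (rule homI)
    fix A assume A: "A \<in> carrier Hab"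
    obtain h where h: "h \<in> H" "A = D #> h" by (rule Hab_cases[OF A])
    have "conj_coset v A = D #> (lift v \<otimes> h \<otimes> inv (lift v))"
      using conj_coset_lift[OF v h(1)] h(2) by (simp only:)
    then show "conj_coset v A \<in> carrier Hab"
      using conj_H[OF lift(1)[OF v] h(1)] by (simp only: Hab_eq imageI)
    fix B assume B: "B \<in> carrier Hab"
    obtain k where k: "k \<in> H" "B = D #> k" by (rule Hab_cases[OF B])
    have hk: "h \<otimes> k \<in> H" using h k subgroup.m_closed[OF H_subgroup] by simp
    have "lift v \<otimes> (h \<otimes> k) \<otimes> inv (lift v) = (lift v \<otimes> h \<otimes> inv (lift v)) \<otimes> (lift v \<otimes> k \<otimes> inv (lift v))"
      using lift(1)[OF v] H_carrier[OF h(1)] H_carrier[OF k(1)] by (simp add: m_assoc inv_solve_left)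
    then show "conj_coset v (A \<otimes>\<^bsub>Hab\<^esub> B) = conj_coset v A \<otimes>\<^bsub>Hab\<^esub> conj_coset v B"
      using conj_H[OF lift(1)[OF v] h(1)] conj_H[OF lift(1)[OF v] k(1)]
      by (simp only: h(2) k(2) Hab_mult[OF h(1) k(1)] conj_coset_lift[OF v] h(1) k(1) hk Hab_mult)
  qed
  show "conj_coset 0 A = A" if A: "A \<in> carrier Hab" for A
  proof -
    obtain h where h: "h \<in> H" "A = D #> h" by (rule Hab_cases[OF A])
    then show ?thesis using conj_coset_eq[of \<one> h] H_carrier[of h] by simp
  qed
  show "conj_coset (u + v) A = conj_coset u (conj_coset v A)"
    if u: "u \<in> carrier (Zpow d)" and v: "v \<in> carrier (Zpow d)" and A: "A \<in> carrier Hab" for u v A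
  proof -
    obtain h where h: "h \<in> H" "A = D #> h" by (rule Hab_cases[OF A])
    have uv: "P (lift u \<otimes> lift v) = u + v" using lift u v by simp
    have c: "lift u \<in> carrier G" "lift v \<in> carrier G" "h \<in> carrier G"
      using lift u v H_carrier h by auto
    have "conj_coset (u + v) A = D #> ((lift u \<otimes> lift v) \<otimes> h \<otimes> inv (lift u \<otimes> lift v))"
      using conj_coset_eq[of "lift u \<otimes> lift v" h] c h by (simp only: uv m_closed)
    also have "(lift u \<otimes> lift v) \<otimes> h \<otimes> inv (lift u \<otimes> lift v)
        = lift u \<otimes> (lift v \<otimes> h \<otimes> inv (lift v)) \<otimes> inv (lift u)"
      using c by (simp add: inv_mult_group m_assoc)
    also have "D #> \<dots> = conj_coset u (conj_coset v A)"
      using c h by (simp only: conj_coset_lift[OF v] conj_coset_lift[OF u] conj_H)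
    finally show ?thesis .
  qed
qed

lemma kernel_to_abelianization:
  "(\<lambda>y. D #> y) \<in> module_hom \<Lambda> N (abelianization_module G P H)"
  unfolding kernel_module_eq abelianization_module_eq
proof (rule module_hom_laurentI[OF N.laurent_action_axioms Hab.laurent_action_axioms])
  show "(\<lambda>y. D #> y) \<in> hom (G\<lparr>carrier := ker\<rparr>) Hab"
  proof (rule homI)
    fix y z assume "y \<in> carrier (G\<lparr>carrier := ker\<rparr>)" "z \<in> carrier (G\<lparr>carrier := ker\<rparr>)"
    then have "y \<in> H" "z \<in> H" using ker_subset_H by auto
    then show "D #> y \<in> carrier Hab" "D #> (y \<otimes>\<^bsub>G\<lparr>carrier := ker\<rparr>\<^esub> z) = (D #> y) \<otimes>\<^bsub>Hab\<^esub> (D #> z)"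
      by (simp_all only: Hab_eq imageI) (simp add: Hab_mult flip: Hab_eq)
  qed
  show "D #> conj_act v y = conj_coset v (D #> y)"
    if "v \<in> carrier (Zpow d)" "y \<in> carrier (G\<lparr>carrier := ker\<rparr>)" for v y
  proof -
    have y: "y \<in> H" using that(2) ker_subset_H by auto
    show ?thesis
      by (simp only: conj_coset_lift[OF that(1) y]) (simp only: Let_def lift_def)
  qed
qed

section \<open>The exact sequences\<close>

definition coord where "coord u = inv_into (carrier (Zpow n)) (Z_lincomb n t) u"

lemma inj_on_Z_lincomb: "inj_on (Z_lincomb n t) (carrier (Zpow n))"
proof (rule inj_onI)
  fix c c' assume c: "c \<in> carrier (Zpow n)" "c' \<in> carrier (Zpow n)" and "Z_lincomb n t c = Z_lincomb n t c'"
  then have "Z_lincomb n t (c - c') = 0" by (simp add: Z_lincomb_diff)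
  moreover have "c - c' \<in> carrier (Zpow n)" using c keys_diff[of c c'] by auto
  ultimately show "c = c'" using basis by (auto simp: Z_basis_def)
qed

lemma coord: "u \<in> Z \<Longrightarrow> coord u \<in> carrier (Zpow n)" "u \<in> Z \<Longrightarrow> Z_lincomb n t (coord u) = u"
  using basis unfolding coord_def Z_basis_def by (metis inv_into_into, metis f_inv_into_f)

lemma coord_lincomb: "c \<in> carrier (Zpow n) \<Longrightarrow> coord (Z_lincomb n t c) = c"
  unfolding coord_def by (rule inv_into_f_f[OF inj_on_Z_lincomb])

lemma coord_add: "\<lbrakk>u \<in> Z; w \<in> Z\<rbrakk> \<Longrightarrow> coord (u + w) = coord u + coord w"
proof -
  assume uw: "u \<in> Z" "w \<in> Z"
  have "Z_lincomb n t (coord u + coord w) = u + w"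
    using Z_lincomb_diff[of n t "coord u + coord w" "coord w"] coord(2) uw by (simp add: algebra_simps)
  then show ?thesis
    using coord_lincomb[of "coord u + coord w"] coord(1)[OF uw(1)] coord(1)[OF uw(2)] add_closed_Zpow by metis
qed

text \<open>
  The map \<open>H/[H, H] \<rightarrow> \<int>\<^sup>n\<close> induced by \<open>P\<close>. The representative is chosen arbitrarily because \<open>P\<close> is constant
  on the cosets of \<open>[H, H] \<subseteq> N\<close>.
\<close>

definition exponents where "exponents A = coord (P (SOME h. h \<in> A))"

lemma exponents_coset:
  assumes h: "h \<in> H"
  shows "exponents (D #> h) = coord (P h)"
proof -
  interpret D: normal D G by (rule D_normal)
  have "P k = P h" if k: "k \<in> D #> h" for k
  proof -
    obtain e where e: "e \<in> D" "k = e \<otimes> h" using k by (auto simp: r_coset_def)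
    have "e \<in> ker" using e(1) D_subset_ker by auto
    then show ?thesis using e(2) H_carrier[OF h] P.hom_mult[of e h] by (simp add: kernel_def)
  qed
  moreover have "h \<in> D #> h" using H_carrier[OF h] by (rule rcos_self) (rule D.subgroup_axioms)
  ultimately show ?thesis unfolding exponents_def by (metis someI)
qed

text \<open>
  Linearity over \<open>\<Lambda>\<close> for the trivial action on \<open>\<int>\<^sup>n\<close> expresses that \<open>P\<close> takes its values in an abelian
  group and is therefore invariant under conjugation.
\<close>

lemma exponents_module_hom:
  "exponents \<in> module_hom \<Lambda> (abelianization_module G P H) (trivial_module n)"
  unfolding abelianization_module_eq trivial_module_def
proof (rule module_hom_laurentI[OF Hab.laurent_action_axioms laurent_action_trivial])
  show "exponents \<in> hom Hab (Zpow n)"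
  proof (rule homI)
    fix A assume A: "A \<in> carrier Hab"
    obtain h where h: "h \<in> H" "A = D #> h" by (rule Hab_cases[OF A])
    then show "exponents A \<in> carrier (Zpow n)"
      using coord(1)[of "P h"] by (simp only: exponents_coset) (simp add: H_def)
    fix B assume B: "B \<in> carrier Hab"
    obtain k where k: "k \<in> H" "B = D #> k" by (rule Hab_cases[OF B])
    have hk: "h \<otimes> k \<in> H" using h k subgroup.m_closed[OF H_subgroup] by simp
    have "P h \<in> Z" "P k \<in> Z" "P (h \<otimes> k) = P h + P k" using h k P.hom_mult[of h k] by (auto simp: H_def)
    then have "exponents (D #> (h \<otimes> k)) = exponents (D #> h) + exponents (D #> k)"
      by (simp only: exponents_coset hk h(1) k(1) coord_add)
    then show "exponents (A \<otimes>\<^bsub>Hab\<^esub> B) = exponents A \<otimes>\<^bsub>Zpow n\<^esub> exponents B"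
      by (simp only: h(2) k(2) Hab_mult[OF h(1) k(1)] mult_free_Abelian_group)
  qed
  show "exponents (conj_coset v A) = exponents A" if v: "v \<in> carrier (Zpow d)" and A: "A \<in> carrier Hab" for v A
  proof -
    obtain h where h: "h \<in> H" "A = D #> h" by (rule Hab_cases[OF A])
    show ?thesis
      using conj_H[OF lift(1)[OF v] h(1)] P_conj[OF lift(1)[OF v] H_carrier[OF h(1)]]
      by (simp only: h(2) conj_coset_lift[OF v h(1)] exponents_coset h(1))
  qed
qed

text \<open>
  Cosets of \<open>[H, H]\<close> in \<open>N\<close> are also cosets in \<open>H\<close>, so injectivity costs nothing. Exactness in the
  middle holds since \<open>N\<close> is the kernel of \<open>P\<close> on \<open>H\<close> and coordinates vanish only at \<open>0\<close>; surjectivity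
  uses that \<open>P\<close> maps \<open>H\<close> onto the whole subgroup spanned by the basis.
\<close>

lemma short_exact_abelianization:
  "short_exact_modules \<Lambda> (quot_module N D) id (abelianization_module G P H) exponents (trivial_module n)"
proof -
  interpret KM: module \<Lambda> N by (rule module_kernel_module)
  interpret DN: abelian_subgroup D N by (rule KM.abelian_subgroup_submodule[OF D_submodule])
  interpret HM: module \<Lambda> "abelianization_module G P H"
    unfolding abelianization_module_eq by (rule Hab.module_laurent_module)
  have HM_eq: "carrier (abelianization_module G P H) = (\<lambda>h. D #> h) ` H"
    "add (abelianization_module G P H) = monoid.mult Hab"
    by (simp_all add: abelianization_module_eq laurent_module_def Hab_eq)
  have quot: "carrier (quot_module N D) = (\<lambda>y. D #> y) ` ker"
    by (simp add: KM.carrier_quot_module carrier_kernel_module a_r_coset_kernel_module)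
  have "id \<in> module_hom \<Lambda> (quot_module N D) (abelianization_module G P H)"
    unfolding module_hom_def
  proof (intro CollectI conjI homI ballI)
    fix A assume "A \<in> carrier (add_monoid (quot_module N D))"
    then obtain a where a: "a \<in> ker" "A = D #> a" unfolding partial_object.simps quot by (elim imageE)
    show "id A \<in> carrier (add_monoid (abelianization_module G P H))"
      using a(1) ker_subset_H by (simp add: HM_eq a(2)) (intro imageI, blast)
    fix B assume "B \<in> carrier (add_monoid (quot_module N D))"
    then obtain b where b: "b \<in> ker" "B = D #> b" unfolding partial_object.simps quot by (elim imageE)
    have "A \<oplus>\<^bsub>quot_module N D\<^esub> B = D +>\<^bsub>N\<^esub> (a \<oplus>\<^bsub>N\<^esub> b)"
      using DN.a_rcos_sum[of a b] a b
      by (simp add: quot_module_def carrier_kernel_module a_r_coset_kernel_module)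
    also have "\<dots> = D #> (a \<otimes> b)"
      by (simp add: a_r_coset_kernel_module) (simp add: kernel_module_def laurent_module_def)
    also have "\<dots> = A \<oplus>\<^bsub>abelianization_module G P H\<^esub> B"
      using Hab_mult[of a b] a(1) b(1) ker_subset_H by (simp add: HM_eq a(2) b(2) subsetD)
    finally show "id (A \<otimes>\<^bsub>add_monoid (quot_module N D)\<^esub> B)
        = id A \<otimes>\<^bsub>add_monoid (abelianization_module G P H)\<^esub> id B"
      by simp
  next
    fix p A assume p: "p \<in> carrier \<Lambda>" and "A \<in> carrier (quot_module N D)"
    then obtain a where a: "a \<in> ker" "A = D #> a" unfolding quot by (elim imageE)
    have "p \<odot>\<^bsub>quot_module N D\<^esub> (D #> a) = D #> (p \<odot>\<^bsub>N\<^esub> a)"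
      using KM.quot_module_smult[OF D_submodule p, of a] a(1)
      by (simp add: carrier_kernel_module a_r_coset_kernel_module)
    also have "\<dots> = p \<odot>\<^bsub>abelianization_module G P H\<^esub> (D #> a)"
      using kernel_to_abelianization p a(1) by (simp add: module_hom_def carrier_kernel_module)
    finally show "id (p \<odot>\<^bsub>quot_module N D\<^esub> A) = p \<odot>\<^bsub>abelianization_module G P H\<^esub> id A"
      using a(2) by simp
  qed
  moreover have "(\<lambda>y. D #> y) ` ker = a_kernel (abelianization_module G P H) (trivial_module n) exponents"
  proof -
    have zero: "\<zero>\<^bsub>trivial_module n\<^esub> = 0"
      by (simp add: trivial_module_def laurent_module_def)
    have kernel_iff: "exponents (D #> h) = 0 \<longleftrightarrow> h \<in> ker" if h: "h \<in> H" for h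
    proof -
      have PZ: "P h \<in> Z" using h by (simp add: H_def)
      have "coord (P h) = 0 \<longleftrightarrow> P h = 0"
        using coord(2)[OF PZ] coord_lincomb[of 0] by (auto simp: Z_lincomb_def)
      then show ?thesis using h by (simp add: exponents_coset) (simp add: kernel_def H_def)
    qed
    have "a_kernel (abelianization_module G P H) (trivial_module n) exponents
        = {A \<in> (\<lambda>h. D #> h) ` H. exponents A = 0}"
      by (simp add: a_kernel_def kernel_def HM_eq zero)
    also have "\<dots> = (\<lambda>y. D #> y) ` ker"
      using kernel_iff ker_subset_H by (intro equalityI subsetI; elim CollectE conjE imageE) (simp_all add: subsetD)
    finally show ?thesis ..
  qed
  moreover have "exponents ` carrier (abelianization_module G P H) = carrier (trivial_module n)"
  proof -
    have "c \<in> exponents ` (\<lambda>h. D #> h) ` H" if c: "c \<in> carrier (Zpow n)" for c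
    proof -
      have cZ: "Z_lincomb n t c \<in> Z" using c basis by (auto simp: Z_basis_def)
      then have "Z_lincomb n t c \<in> carrier (Zpow d)" using subgroup.subset[OF Z_subgroup] by blast
      then obtain h where "h \<in> carrier G" "P h = Z_lincomb n t c" using lift by blast
      then have "h \<in> H" "exponents (D #> h) = c"
        using cZ exponents_coset[of h] coord_lincomb[OF c] by (simp_all add: H_def)
      then show ?thesis by blast
    qed
    moreover have "exponents (D #> h) \<in> carrier (Zpow n)" if "h \<in> H" for h
      using that coord(1)[of "P h"] by (simp only: exponents_coset) (simp add: H_def)
    ultimately show ?thesis
      by (auto simp: HM_eq trivial_module_def laurent_module_def simp del: carrier_free_Abelian_group_iff)
  qed
  moreover have "Module.module \<Lambda> (trivial_module n)"
    unfolding trivial_module_def by (rule laurent_action.module_laurent_module[OF laurent_action_trivial])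
  ultimately show ?thesis
    unfolding short_exact_modules_def
    by (simp add: KM.module_quot_module[OF D_submodule] HM.module_axioms exponents_module_hom quot)
qed

end

theorem theorem6p1:
  fixes G :: "('a, 'b) monoid_scheme"
    and P :: "'a \<Rightarrow> (nat \<Rightarrow>\<^sub>0 int)"
    and d d' :: nat
    and Z :: "(nat \<Rightarrow>\<^sub>0 int) set"
    and t' :: "nat \<Rightarrow> (nat \<Rightarrow>\<^sub>0 int)"
    and x' :: "nat \<Rightarrow> 'a"
  assumes "group G"
    and "P \<in> hom G (Zpow d)"
    and "P ` carrier G = carrier (Zpow d)"
    and "comm_group (G\<lparr>carrier := kernel G (Zpow d) P\<rparr>)"
    and \<Lambda>: "\<Lambda> = laurent_ring d"
    and N: "N = kernel_module G d P"
    and "subgroup Z (Zpow d)"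
    and "d' \<le> d"
    and "(Zpow d)\<lparr>carrier := Z\<rparr> \<cong> Zpow d'"
    and H: "H = {x \<in> carrier G. P x \<in> Z}"
    and "Z_basis d' t' Z"
    and "\<And>i. i < d' \<Longrightarrow> x' i \<in> carrier G \<and> P (x' i) = t' i"
    and I: "I = Idl\<^bsub>\<Lambda>\<^esub> {laurent_monom (t' i) - 1 | i. i < d'}"
    and C: "C = gen_submodule \<Lambda> N
                  {x' i \<otimes>\<^bsub>G\<^esub> x' j \<otimes>\<^bsub>G\<^esub> inv\<^bsub>G\<^esub> (x' i) \<otimes>\<^bsub>G\<^esub> inv\<^bsub>G\<^esub> (x' j) | i j. i < j \<and> j < d'}"
    and IN: "IN = ideal_smult \<Lambda> N I"
    and D: "D = derived (G\<lparr>carrier := H\<rparr>) H"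
  shows "(\<exists>f g. short_exact_modules \<Lambda>
                  (quot_module N (C <+>\<^bsub>N\<^esub> IN)) f
                  (abelianization_module G P H) g
                  (trivial_module d')
              \<and> (\<forall>y \<in> carrier N. f ((C <+>\<^bsub>N\<^esub> IN) +>\<^bsub>N\<^esub> y) = D #>\<^bsub>G\<^esub> y)
              \<and> (\<forall>h \<in> H. Z_lincomb d' t' (g (D #>\<^bsub>G\<^esub> h)) = P h))
       \<and> (\<exists>f g. short_exact_modules \<Lambda>
                  (quot_module (N\<lparr>carrier := C <+>\<^bsub>N\<^esub> IN\<rparr>) IN) f
                  (quot_module N IN) g
                  (quot_module N (C <+>\<^bsub>N\<^esub> IN))
              \<and> (\<forall>y \<in> C <+>\<^bsub>N\<^esub> IN. f (IN +>\<^bsub>N\<^esub> y) = IN +>\<^bsub>N\<^esub> y)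
              \<and> (\<forall>y \<in> carrier N. g (IN +>\<^bsub>N\<^esub> y) = (C <+>\<^bsub>N\<^esub> IN) +>\<^bsub>N\<^esub> y))"
proof -
  interpret E: Zpow_extension_basis G d P d' Z t' x'
    using assms(1-4,7,11,12)
    by (intro Zpow_extension_basis.intro Zpow_extension.intro Zpow_extension_axioms.intro
        Zpow_extension_basis_axioms.intro)
  have [simp]: "\<Lambda> = E.\<Lambda>" "N = E.N" "H = E.H" "I = E.I" "C = E.C" "IN = E.IN"
    unfolding \<Lambda> N H I C IN by (simp_all add: E.H_def E.I_def E.C_def)
  have D_eq: "D = E.D"
    unfolding D using E.derived_consistent[OF order.refl E.H_subgroup] by simp
  interpret KM: module E.\<Lambda> E.N by (rule E.module_kernel_module)
  have K: "submodule (E.C <+>\<^bsub>E.N\<^esub> E.IN) E.\<Lambda> E.N" and IK: "E.IN \<subseteq> E.C <+>\<^bsub>E.N\<^esub> E.IN"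
    using KM.submodule_set_add KM.subset_set_add(2) E.C_submodule E.IN_submodule by auto
  have "Z_lincomb d' t' (E.exponents (E.D #>\<^bsub>G\<^esub> h)) = P h" if "h \<in> E.H" for h
    using that E.exponents_coset[OF that] E.coord(2)[of "P h"] by (simp add: E.H_def)
  then have 1: "short_exact_modules \<Lambda> (quot_module N (C <+>\<^bsub>N\<^esub> IN)) id
        (abelianization_module G P H) E.exponents (trivial_module d')
      \<and> (\<forall>y \<in> carrier N. id ((C <+>\<^bsub>N\<^esub> IN) +>\<^bsub>N\<^esub> y) = D #>\<^bsub>G\<^esub> y)
      \<and> (\<forall>h \<in> H. Z_lincomb d' t' (E.exponents (D #>\<^bsub>G\<^esub> h)) = P h)"
    using E.short_exact_abelianization E.derived_preimage
    by (simp add: D_eq E.a_r_coset_kernel_module)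
  have 2: "short_exact_modules \<Lambda> (quot_module (N\<lparr>carrier := C <+>\<^bsub>N\<^esub> IN\<rparr>) IN) id
        (quot_module N IN) (\<lambda>A. (C <+>\<^bsub>N\<^esub> IN) <+>\<^bsub>N\<^esub> A) (quot_module N (C <+>\<^bsub>N\<^esub> IN))
      \<and> (\<forall>y \<in> C <+>\<^bsub>N\<^esub> IN. id (IN +>\<^bsub>N\<^esub> y) = IN +>\<^bsub>N\<^esub> y)
      \<and> (\<forall>y \<in> carrier N. (C <+>\<^bsub>N\<^esub> IN) <+>\<^bsub>N\<^esub> (IN +>\<^bsub>N\<^esub> y) = (C <+>\<^bsub>N\<^esub> IN) +>\<^bsub>N\<^esub> y)"
    using KM.short_exact_submodule_quotients[OF E.IN_submodule K IK]
      KM.quotient_map_in_module_hom(2)[OF E.IN_submodule K IK] by simp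
  from 1 2 show ?thesis by blast
qed

end
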